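(* Consider the problem (P) with solution set $\Omega_P$ and its restricted dual (D), both defined in the context, and let $(\mathbf w^*,\mathbf z^* )$ be the unique optimal solution of (D). Let $r$ be a positive scalar with $\sum_{k=0}^{+\infty}\epsilon_k<r$. Let $\{(\mathbf w^k,\mathbf z^k,\mathbf x^k)\}$ be any infinite sequence generated by the augmented Lagrangian method described in the context, with the subproblems $\min\{\psi^k(\mathbf w)\mid \mathbf w\in\mathrm{Ran}(Q)\}$ solved inexactly under the stopping criteria (A$'$) and (B$'$) of the context. Then the sequence $\{\mathbf x^k\}$ converges to some $\mathbf x^*\in\Omega_P$, and the sequence $\{(\mathbf w^k,\mathbf z^k)\}$ converges to the unique optimal solution $(\mathbf w^*,\mathbf z^* )$ of (D). Moreover, if $\mathrm{dist}(\mathbf x^0,\Omega_P)\le r-\sum_{k=0}^{+\infty}\epsilon_k$, then for all $k>0$ $$\mathrm{dist}(\mathbf x^{k+1},\Omega_P)\le\mu_k\,\mathrm{dist}(\mathbf x^k,\Omega_P),$$ $$\|(\mathbf w^{k+1},\mathbf z^{k+1})-(\mathbf w^*,\mathbf z^* )\|\le\mu_k'\,\|\mathbf x^{k+1}-\mathbf x^k\|,$$ where $$\mu_k:=\frac{\delta_k+(1+\delta_k)\,\kappa_f(r)/\sqrt{\kappa_f^2(r)+\sigma_k^2}}{1-\delta_k}\ \to\ \mu_\infty:=\frac{\kappa_f(r)}{\sqrt{\kappa_f^2(r)+\sigma_\infty^2}},$$ $$\mu_k':=\kappa_l(r)\sqrt{\frac1{\sigma_k^2}+\frac{\tilde\lambda_{\min}(Q)\,\delta_k^2}{\sigma_k}}\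 \to\ \mu_\infty':=\frac{\kappa_l(r)}{\sigma_\infty},$$ $\sigma_\infty$ denotes the limit of $\sigma_k$, and $\kappa_f(r),\kappa_l(r)>0$ are the constants associated with $r$ by the error bounds (E) of the context, taken at the base point $(\bar{\mathbf w},\bar{\mathbf z},\bar{\mathbf x})=(\mathbf w^*,\mathbf z^*,\mathbf x^* )$. Moreover, $\mu_k$ and $\mu_k'$ go to $0$ as $\sigma_k\uparrow\sigma_\infty=+\infty$.
   Context: Data: $Q\in\mathbb R^{n\times n}$ is symmetric positive semidefinite, $\mathbf c,\mathbf a,\mathbf l,\mathbf u\in\mathbb R^n$, $d\in\mathbb R$, and $l_i<u_i$ for all $i$. Let $L=\{\mathbf x\in\mathbb R^n\mid \mathbf a^T\mathbf x=d\}$ and $K=\{\mathbf x\in\mathbb R^n\mid \mathbf l\le\mathbf x\le\mathbf u\}$. $\delta_{K\cap L}$ is the indicator function of $K\cap L$ ($0$ on the set, $+\infty$ off it), $\delta^*_{K\cap L}$ its convex conjugate, $\Pi_{K\cap L}$ the Euclidean projection onto $K\cap L$, and $\mathrm{Ran}(Q)$ the range of $Q$. $\tilde\lambda_{\min}(Q)$ is the minimum nonzero eigenvalue of $Q$. Norms are Euclidean, $\mathrm{dist}(x,S)=\inf_{y\in S}\|x-y\|$, and $\mathrm{dist}(x,\emptyset)=+\infty$. Problem (P): $\min_{\mathbf x\in\mathbb R^n}\ f(\mathbf x):=\frac12\langle\mathbf x,Q\mathbf x\rangle+\langle\mathbf c,\mathbf x\rangle+\delta_{K\cap L}(\mathbf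 x)$. Problem (D): $\min_{\mathbf w,\mathbf z\in\mathbb R^n}\ \{\frac12\langle\mathbf w,Q\mathbf w\rangle+\delta^*_{K\cap L}(\mathbf z)\mid Q\mathbf w+\mathbf z+\mathbf c=0,\ \mathbf w\in\mathrm{Ran}(Q)\}$. Operators: $\mathcal T_f(\mathbf x)=\partial f(\mathbf x)$. The Lagrangian of (D) is $l(\mathbf w,\mathbf z,\mathbf x)=\frac12\langle\mathbf w,Q\mathbf w\rangle+\delta^*_{K\cap L}(\mathbf z)-\langle\mathbf x,Q\mathbf w+\mathbf z+\mathbf c\rangle$ for $\mathbf w\in\mathrm{Ran}(Q)$ and $+\infty$ otherwise, and $\mathcal T_l(\mathbf w,\mathbf z,\mathbf x)=\{(\mathbf u_w,\mathbf u_z,\mathbf u_x)\mid(\mathbf u_w,\mathbf u_z,-\mathbf u_x)\in\partial l(\mathbf w,\mathbf z,\mathbf x)\}$, where $\partial l$ is the subdifferential of the convex-concave function $l$ (convex in $(\mathbf w,\mathbf z)$, concave in $\mathbf x$). $\mathcal T_f^{-1}(\mathbf 0)=\{\mathbf x\mid\mathbf 0\in\mathcal T_f(\mathbf x)\}=\Omega_P$ and $\mathcal T_l^{-1}(\mathbf 0)=\{(\mathbf w,\mathbf z,\mathbf x)\mid\mathbf 0\in\mathcal T_l(\mathbf w,\mathbf z,\mathbf x)\}$. Error bounds (E): for any $r>0$ and $(\bar{\mathbf w},\bar{\mathbf z},\bar{\mathbf x})\in\mathcal T_l^{-1}(\mathbf 0)$ there exist $\kappa_f(r)>0$ and $\kappa_l(r)>0$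 such that $$\mathrm{dist}(\mathbf x,\mathcal T_f^{-1}(\mathbf 0))\le\kappa_f(r)\,\mathrm{dist}(\mathbf 0,\mathcal T_f(\mathbf x))\quad\text{whenever } \mathrm{dist}(\mathbf x,\mathcal T_f^{-1}(\mathbf 0))\le r,$$ $$\mathrm{dist}\big((\mathbf w,\mathbf z,\mathbf x),\mathcal T_l^{-1}(\mathbf 0)\big)\le\kappa_l(r)\,\mathrm{dist}\big(\mathbf 0,\mathcal T_l(\mathbf w,\mathbf z,\mathbf x)\big)\quad\text{whenever } \|(\mathbf w,\mathbf z,\mathbf x)-(\bar{\mathbf w},\bar{\mathbf z},\bar{\mathbf x})\|\le r.$$ Augmented Lagrangian method: $\sigma_0>0$ and $\mathbf x^0\in\mathbb R^n$ are given, and the penalty parameter $\sigma_k>0$ is updated to $\sigma_{k+1}>0$ at the end of each iteration. For $k=0,1,2,\dots$, put $\mathbf u(\mathbf w)=\mathbf x^k-\sigma_k(Q\mathbf w+\mathbf c)$ and $$\psi^k(\mathbf w)=\tfrac12\langle\mathbf w,Q\mathbf w\rangle+\tfrac1{2\sigma_k}\big(\|\mathbf u(\mathbf w)\|^2-\|\mathbf u(\mathbf w)-\Pi_{K\cap L}(\mathbf u(\mathbf w))\|^2\big)-\tfrac1{2\sigma_k}\|\mathbf x^k\|^2,$$ which equals $\inf_{\mathbf z}\{\frac12\langle\mathbf w,Q\mathbf w\rangle+\delta^*_{K\cap L}(\mathbf z)+\frac{\sigma_k}2\|Q\mathbf w+\mathbf z+\mathbf c-\frac1{\sigma_k}\mathbf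 x^k\|^2-\frac1{2\sigma_k}\|\mathbf x^k\|^2\}$ and has gradient $\nabla\psi^k(\mathbf w)=Q\mathbf w-Q\Pi_{K\cap L}(\mathbf u(\mathbf w))$. Choose $\mathbf w^{k+1}\in\mathrm{Ran}(Q)$ as an approximate minimizer of $\psi^k$ over $\mathrm{Ran}(Q)$, and set $\mathbf z^{k+1}=\sigma_k^{-1}\big(\mathbf u(\mathbf w^{k+1})-\Pi_{K\cap L}(\mathbf u(\mathbf w^{k+1}))\big)$ and $\mathbf x^{k+1}=\mathbf x^k-\sigma_k(Q\mathbf w^{k+1}+\mathbf z^{k+1}+\mathbf c)=\Pi_{K\cap L}(\mathbf u(\mathbf w^{k+1}))$. Stopping criteria: (A$'$) $\|\nabla\psi^k(\mathbf w^{k+1})\|\le\sqrt{\tilde\lambda_{\min}(Q)}\,\epsilon_k/\sqrt{\sigma_k}$, with $\epsilon_k\ge0$, $\sum_{k=0}^{+\infty}\epsilon_k<+\infty$; (B$'$) $\|\nabla\psi^k(\mathbf w^{k+1})\|\le\sqrt{\tilde\lambda_{\min}(Q)}\,(\delta_k/\sqrt{\sigma_k})\,\|\mathbf x^{k+1}-\mathbf x^k\|$, with $\delta_k\ge0$, $\sum_{k=0}^{+\infty}\delta_k<+\infty$.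
   Formalization: Formally, K∩L is nonempty and σ_∞>0; the primal rate is claimed only when δ_k<1 (else μ_k is negative or undefined); the dual rate only if the new iterate lies in the radius-r ball of (E) or κ_l(r) exceeds a threshold depending on the data, r and κ_f, since it can fail otherwise. *)

theory Defs
  imports "HOL-Analysis.Analysis"
begin

(* Distance to a set with values in the extended reals: the library's infdist returns 0 for the
   empty set, whereas here the distance to the empty set is infinite (empty infimum in ereal). *)
definition pt_dist :: "'a::real_normed_vector \<Rightarrow> 'a set \<Rightarrow> ereal" where
  "pt_dist x S = (INF y\<in>S. ereal (norm (x - y)))"

definition indicator_fn :: "'a set \<Rightarrow> 'a \<Rightarrow> ereal" where
  "indicator_fn S x = (if x \<in> S then 0 else \<infinity>)"

definition convex_conjugate :: "('a::real_inner \<Rightarrow> ereal) \<Rightarrow> 'a \<Rightarrow> ereal" where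
  "convex_conjugate f y = (SUP x. ereal (y \<bullet> x) - f x)"

(* For a function that is not identically infinite, the subdifferential is empty wherever
   the function is infinite. *)
definition subdifferential :: "('a::real_inner \<Rightarrow> ereal) \<Rightarrow> 'a \<Rightarrow> 'a set" where
  "subdifferential f x = {v. \<forall>y. f x + ereal (v \<bullet> (y - x)) \<le> f y}"

definition superdifferential :: "('a::real_inner \<Rightarrow> ereal) \<Rightarrow> 'a \<Rightarrow> 'a set" where
  "superdifferential g x = {v. \<forall>y. g y \<le> g x + ereal (v \<bullet> (y - x))}"

definition gradient :: "('a::real_inner \<Rightarrow> real) \<Rightarrow> 'a \<Rightarrow> 'a" where
  "gradient f x = (THE D. GDERIV f x :> D)"

definition Ran :: "real^'n^'n \<Rightarrow> (real^'n) set" where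
  "Ran Q = range (\<lambda>x. Q *v x)"

(* The zero matrix has no nonzero eigenvalue; the value 0 chosen for it turns the factor
   sqrt (min_nonzero_eigenvalue Q) in the stopping criteria into 0, and these then just say
   that the gradient (which vanishes for Q = 0) is 0. *)
definition min_nonzero_eigenvalue :: "real^'n^'n \<Rightarrow> real" where
  "min_nonzero_eigenvalue Q =
     (if Q = 0 then 0 else Min {\<mu>. \<mu> \<noteq> 0 \<and> (\<exists>v. v \<noteq> 0 \<and> Q *v v = \<mu> *\<^sub>R v)})"

definition feasible_set ::
    "real^'n \<Rightarrow> real \<Rightarrow> real^'n \<Rightarrow> real^'n \<Rightarrow> (real^'n) set" where
  "feasible_set a d l u = {x. \<forall>i. l $ i \<le> x $ i \<and> x $ i \<le> u $ i} \<inter> {x. a \<bullet> x = d}"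

(* In what follows S stands for the feasible set of the primal problem. *)

definition primal_obj ::
    "real^'n^'n \<Rightarrow> real^'n \<Rightarrow> (real^'n) set \<Rightarrow> real^'n \<Rightarrow> ereal" where
  "primal_obj Q c S x = ereal (1/2 * (x \<bullet> (Q *v x)) + c \<bullet> x) + indicator_fn S x"

definition primal_solutions ::
    "real^'n^'n \<Rightarrow> real^'n \<Rightarrow> (real^'n) set \<Rightarrow> (real^'n) set" where
  "primal_solutions Q c S = {x. \<forall>y. primal_obj Q c S x \<le> primal_obj Q c S y}"

definition dual_obj ::
    "real^'n^'n \<Rightarrow> (real^'n) set \<Rightarrow> real^'n \<Rightarrow> real^'n \<Rightarrow> ereal" where
  "dual_obj Q S w z = ereal (1/2 * (w \<bullet> (Q *v w))) + convex_conjugate (indicator_fn S) z"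

definition dual_feasible ::
    "real^'n^'n \<Rightarrow> real^'n \<Rightarrow> real^'n \<Rightarrow> real^'n \<Rightarrow> bool" where
  "dual_feasible Q c w z \<longleftrightarrow> Q *v w + z + c = 0 \<and> w \<in> Ran Q"

definition dual_solutions ::
    "real^'n^'n \<Rightarrow> real^'n \<Rightarrow> (real^'n) set \<Rightarrow> ((real^'n) \<times> (real^'n)) set" where
  "dual_solutions Q c S = {(w, z). dual_feasible Q c w z \<and>
     (\<forall>w' z'. dual_feasible Q c w' z' \<longrightarrow> dual_obj Q S w z \<le> dual_obj Q S w' z')}"

definition T_f ::
    "real^'n^'n \<Rightarrow> real^'n \<Rightarrow> (real^'n) set \<Rightarrow> real^'n \<Rightarrow> (real^'n) set" where
  "T_f Q c S x = subdifferential (primal_obj Q c S) x"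

definition lagrangian ::
    "real^'n^'n \<Rightarrow> real^'n \<Rightarrow> (real^'n) set \<Rightarrow> real^'n \<Rightarrow> real^'n \<Rightarrow> real^'n \<Rightarrow> ereal" where
  "lagrangian Q c S w z x =
     (if w \<in> Ran Q then dual_obj Q S w z - ereal (x \<bullet> (Q *v w + z + c)) else \<infinity>)"

(* The subdifferential of a convex-concave function is the product of the subdifferential in
   the convex argument and the superdifferential in the concave argument. *)
definition T_l ::
    "real^'n^'n \<Rightarrow> real^'n \<Rightarrow> (real^'n) set \<Rightarrow> (real^'n) \<times> (real^'n) \<times> (real^'n)
      \<Rightarrow> ((real^'n) \<times> (real^'n) \<times> (real^'n)) set" where
  "T_l Q c S = (\<lambda>(w, z, x). {(uw, uz, ux).
      (uw, uz) \<in> subdifferential (\<lambda>(w', z'). lagrangian Q c S w' z' x) (w, z) \<and>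
      - ux \<in> superdifferential (\<lambda>x'. lagrangian Q c S w z x') x})"

definition T_f_zeros :: "real^'n^'n \<Rightarrow> real^'n \<Rightarrow> (real^'n) set \<Rightarrow> (real^'n) set" where
  "T_f_zeros Q c S = {x. 0 \<in> T_f Q c S x}"

definition T_l_zeros ::
    "real^'n^'n \<Rightarrow> real^'n \<Rightarrow> (real^'n) set \<Rightarrow> ((real^'n) \<times> (real^'n) \<times> (real^'n)) set" where
  "T_l_zeros Q c S = {p. 0 \<in> T_l Q c S p}"

definition error_bound_f ::
    "real^'n^'n \<Rightarrow> real^'n \<Rightarrow> (real^'n) set \<Rightarrow> real \<Rightarrow> real \<Rightarrow> bool" where
  "error_bound_f Q c S r \<kappa> \<longleftrightarrow>
     (\<forall>x. pt_dist x (T_f_zeros Q c S) \<le> ereal r \<longrightarrow>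
          pt_dist x (T_f_zeros Q c S) \<le> ereal \<kappa> * pt_dist 0 (T_f Q c S x))"

definition error_bound_l ::
    "real^'n^'n \<Rightarrow> real^'n \<Rightarrow> (real^'n) set \<Rightarrow> real \<Rightarrow> (real^'n) \<times> (real^'n) \<times> (real^'n)
      \<Rightarrow> real \<Rightarrow> bool" where
  "error_bound_l Q c S r p0 \<kappa> \<longleftrightarrow>
     (\<forall>p. norm (p - p0) \<le> r \<longrightarrow>
          pt_dist p (T_l_zeros Q c S) \<le> ereal \<kappa> * pt_dist 0 (T_l Q c S p))"

definition alm_u :: "real^'n^'n \<Rightarrow> real^'n \<Rightarrow> real \<Rightarrow> real^'n \<Rightarrow> real^'n \<Rightarrow> real^'n" where
  "alm_u Q c s x w = x - s *\<^sub>R (Q *v w + c)"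

definition alm_psi ::
    "real^'n^'n \<Rightarrow> real^'n \<Rightarrow> (real^'n) set \<Rightarrow> real \<Rightarrow> real^'n \<Rightarrow> real^'n \<Rightarrow> real" where
  "alm_psi Q c S s x w =
     1/2 * (w \<bullet> (Q *v w))
     + 1 / (2 * s) * ((norm (alm_u Q c s x w))\<^sup>2
         - (norm (alm_u Q c s x w - closest_point S (alm_u Q c s x w)))\<^sup>2)
     - 1 / (2 * s) * (norm x)\<^sup>2"

(* w 0 and z 0 are not constrained: only x 0 is an input of the method. *)
definition alm_iterates ::
    "real^'n^'n \<Rightarrow> real^'n \<Rightarrow> (real^'n) set \<Rightarrow> (nat \<Rightarrow> real)
      \<Rightarrow> (nat \<Rightarrow> real^'n) \<Rightarrow> (nat \<Rightarrow> real^'n) \<Rightarrow> (nat \<Rightarrow> real^'n) \<Rightarrow> bool" where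
  "alm_iterates Q c S \<sigma> w z x \<longleftrightarrow>
     (\<forall>k. 0 < \<sigma> k \<and> w (Suc k) \<in> Ran Q \<and>
        z (Suc k) = (1 / \<sigma> k) *\<^sub>R (alm_u Q c (\<sigma> k) (x k) (w (Suc k))
                      - closest_point S (alm_u Q c (\<sigma> k) (x k) (w (Suc k)))) \<and>
        x (Suc k) = x k - \<sigma> k *\<^sub>R (Q *v w (Suc k) + z (Suc k) + c))"

definition stopping_A ::
    "real^'n^'n \<Rightarrow> real^'n \<Rightarrow> (real^'n) set \<Rightarrow> (nat \<Rightarrow> real) \<Rightarrow> (nat \<Rightarrow> real)
      \<Rightarrow> (nat \<Rightarrow> real^'n) \<Rightarrow> (nat \<Rightarrow> real^'n) \<Rightarrow> bool" where
  "stopping_A Q c S \<epsilon> \<sigma> w x \<longleftrightarrow>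
     (\<forall>k. 0 \<le> \<epsilon> k) \<and> summable \<epsilon> \<and>
     (\<forall>k. norm (gradient (alm_psi Q c S (\<sigma> k) (x k)) (w (Suc k)))
          \<le> sqrt (min_nonzero_eigenvalue Q) * \<epsilon> k / sqrt (\<sigma> k))"

definition stopping_B ::
    "real^'n^'n \<Rightarrow> real^'n \<Rightarrow> (real^'n) set \<Rightarrow> (nat \<Rightarrow> real) \<Rightarrow> (nat \<Rightarrow> real)
      \<Rightarrow> (nat \<Rightarrow> real^'n) \<Rightarrow> (nat \<Rightarrow> real^'n) \<Rightarrow> bool" where
  "stopping_B Q c S \<delta> \<sigma> w x \<longleftrightarrow>
     (\<forall>k. 0 \<le> \<delta> k) \<and> summable \<delta> \<and>
     (\<forall>k. norm (gradient (alm_psi Q c S (\<sigma> k) (x k)) (w (Suc k)))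
          \<le> sqrt (min_nonzero_eigenvalue Q) * (\<delta> k / sqrt (\<sigma> k)) * norm (x (Suc k) - x k))"

(* Meaningful as a contraction factor only for \<delta> < 1. *)
definition primal_rate :: "real \<Rightarrow> real \<Rightarrow> real \<Rightarrow> real" where
  "primal_rate \<kappa> s \<delta> = (\<delta> + (1 + \<delta>) * \<kappa> / sqrt (\<kappa>\<^sup>2 + s\<^sup>2)) / (1 - \<delta>)"

definition dual_rate :: "real^'n^'n \<Rightarrow> real \<Rightarrow> real \<Rightarrow> real \<Rightarrow> real" where
  "dual_rate Q \<kappa> s \<delta> = \<kappa> * sqrt (1 / s\<^sup>2 + min_nonzero_eigenvalue Q * \<delta>\<^sup>2 / s)"

end

theory Submission
  imports Defs
begin

text \<open>The method is the inexact proximal point method for the primal problem in disguise. With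
  \<open>e = Q *v w - Q *v x\<close> for the new iterates \<open>w\<close> and \<open>x\<close>, which is the gradient of the inner
  objective, the new multiplier satisfies
  \<open>(x\<^sub>o\<^sub>l\<^sub>d - x) / \<sigma> - e - (Q *v x + c) \<in> normal_cone S x\<close>,
  so it is the proximal point of \<open>x\<^sub>o\<^sub>l\<^sub>d\<close> up to the perturbation \<open>e\<close>. Since \<open>e\<close> lies in the range
  of \<open>Q\<close>, the curvature of the quadratic form absorbs it at the cost of \<open>t\<^sup>2 / 4\<close> when
  \<open>norm e \<le> sqrt (min_nonzero_eigenvalue Q) * t\<close> (\<open>perturbation_absorbed\<close>). The resulting
  inequality \<open>inexact_proximal_step\<close> carries the whole proof.

  Compared with a primal solution, it makes the iterates quasi-Fejer monotone with vanishing steps,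
  and compactness of the feasible set gives the primal limit (\<open>primal_convergence\<close>). The dual
  iterates follow: \<open>Q *v w\<close> approaches \<open>Q *v x\<close>, on its range \<open>Q\<close> is invertible, and the dual
  solution is the range element with the same image as the primal solutions together with
  \<open>- (Q *v x + c)\<close> (\<open>dual_solutionI\<close>, \<open>dual_convergence\<close>).

  For the primal rate, the inequality bounds the distance of the iterate to the exact proximal
  point, where the error bound for the subdifferential of the primal objective gives the
  contraction factor \<open>\<kappa> / sqrt (\<kappa>\<^sup>2 + \<sigma>\<^sup>2)\<close> (\<open>primal_rate_step\<close>). For the dual rate, the triple
  \<open>(e, 0, (x\<^sub>o\<^sub>l\<^sub>d - x) / \<sigma>)\<close> belongs to \<open>T_l\<close> at the new iterate, and the norm of this triple is what
  \<open>dual_rate\<close> measures. Inside the ball of radius \<open>r\<close> the error bound for \<open>T_l\<close> applies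
  (\<open>dual_distance_near\<close>). Outside it, the same residual still bounds the distance to the dual
  solution up to a constant \<open>K \<kappa>f\<close> that comes from the primal error bound alone
  (\<open>dual_distance_far\<close>).\<close>

section \<open>Positive semidefinite matrices on their range\<close>

lemma linear_term_zero:
  fixes b C :: real
  assumes "\<And>t. 0 \<le> 2 * t * b + t\<^sup>2 * C"
  shows "b = 0"
proof -
  define D where "D = \<bar>C\<bar> + 1"
  define t where "t = - b / D"
  have D: "0 < D" "C < 2 * D" and tD: "t * D = - b"
    by (auto simp: D_def t_def)
  have "0 \<le> (2 * t * b + t\<^sup>2 * C) * D\<^sup>2"
    using assms[of t] by simp
  also have "\<dots> = 2 * (t * D) * b * D + (t * D)\<^sup>2 * C"
    by (simp add: power2_eq_square algebra_simps)
  also have "\<dots> = - (b\<^sup>2 * (2 * D - C))"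
    unfolding tD by (simp add: power2_eq_square algebra_simps)
  finally have "b\<^sup>2 * (2 * D - C) \<le> 0" by simp
  then show ?thesis
    using D by (simp add: mult_le_0_iff)
qed

locale psd_matrix =
  fixes Q :: "real^'n^'n"
  assumes symmetric: "transpose Q = Q"
    and psd: "0 \<le> v \<bullet> (Q *v v)"
begin

lemma inner_swap: "x \<bullet> (Q *v y) = (Q *v x) \<bullet> y"
  by (metis dot_lmul_matrix symmetric vector_transpose_matrix)

lemma subspace_Ran: "subspace (Ran Q)"
  unfolding Ran_def using linear_subspace_image[OF matrix_vector_mul_linear subspace_UNIV] .

lemma mult_in_Ran [simp]: "Q *v x \<in> Ran Q"
  by (simp add: Ran_def)

lemma Ran_kernel_trivial:
  assumes "w \<in> Ran Q" "Q *v w = 0"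
  shows "w = 0"
proof -
  obtain y where "w = Q *v y"
    using assms(1) by (auto simp: Ran_def)
  then have "w \<bullet> w = y \<bullet> (Q *v w)"
    by (simp add: inner_swap)
  then show ?thesis
    using assms(2) by simp
qed

text \<open>The orthogonal complement of the range is the kernel, so the range component of \<open>x\<close> has the
  same image as \<open>x\<close>.\<close>

lemma Ran_component:
  obtains y where "y \<in> Ran Q" "Q *v y = Q *v x" "\<And>v. v \<in> Ran Q \<Longrightarrow> v \<bullet> x = v \<bullet> y"
proof -
  obtain y n where y: "y \<in> span (Ran Q)" and n: "\<And>w. w \<in> span (Ran Q) \<Longrightarrow> orthogonal n w"
    and x: "x = y + n"
    using orthogonal_subspace_decomp_exists[of "Ran Q" x] by metis
  have sp: "span (Ran Q) = Ran Q"
    using subspace_Ran by (simp add: span_eq_iff)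
  have nz: "v \<bullet> n = 0" if "v \<in> Ran Q" for v
    using n[of v] that sp by (simp add: orthogonal_def inner_commute)
  have "(Q *v n) \<bullet> (Q *v n) = 0"
    using nz[of "Q *v (Q *v n)"] by (simp add: inner_swap)
  then have "Q *v n = 0" by simp
  then show ?thesis
    using that[of y] y sp x nz by (simp add: matrix_vector_right_distrib inner_add_right)
qed

lemma eigenvalue_nonneg:
  assumes "Q *v v = \<mu> *\<^sub>R v" "v \<noteq> 0"
  shows "0 \<le> \<mu>"
proof (rule ccontr)
  assume "\<not> 0 \<le> \<mu>"
  moreover have "0 < v \<bullet> v"
    using assms(2) by simp
  ultimately have "\<mu> * (v \<bullet> v) < 0"
    by (intro mult_neg_pos) auto
  then show False
    using psd[of v] by (simp add: assms(1))
qed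

text \<open>Eigenvectors of distinct eigenvalues are orthogonal, hence independent. Without finiteness the
  \<open>Min\<close> in \<open>min_nonzero_eigenvalue\<close> would have no meaning.\<close>

lemma finite_eigenvalues: "finite {\<mu>. \<mu> \<noteq> 0 \<and> (\<exists>v. v \<noteq> 0 \<and> Q *v v = \<mu> *\<^sub>R v)}"
proof -
  define E where "E = {\<mu>. \<mu> \<noteq> 0 \<and> (\<exists>v. v \<noteq> 0 \<and> Q *v v = \<mu> *\<^sub>R v)}"
  have "\<forall>\<mu>\<in>E. \<exists>v. v \<noteq> 0 \<and> Q *v v = \<mu> *\<^sub>R v"
    unfolding E_def by blast
  then obtain f where f: "\<forall>\<mu>\<in>E. f \<mu> \<noteq> 0 \<and> Q *v f \<mu> = \<mu> *\<^sub>R f \<mu>"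
    by (rule bchoice[THEN exE])
  have f0: "f \<mu> \<noteq> 0" and fQ: "Q *v f \<mu> = \<mu> *\<^sub>R f \<mu>" if "\<mu> \<in> E" for \<mu>
    using f that by blast+
  have inj: "inj_on f E"
  proof (rule inj_onI)
    fix \<mu> \<nu> assume E: "\<mu> \<in> E" "\<nu> \<in> E" and eq: "f \<mu> = f \<nu>"
    have "\<mu> *\<^sub>R f \<mu> = \<nu> *\<^sub>R f \<mu>"
      using fQ[OF E(1)] fQ[OF E(2)] unfolding eq by (rule trans[OF sym])
    then show "\<mu> = \<nu>"
      using f0[OF E(1)] by (simp only: scaleR_cancel_right) blast
  qed
  have orth: "f \<mu> \<bullet> f \<nu> = 0" if E: "\<mu> \<in> E" "\<nu> \<in> E" and "\<mu> \<noteq> \<nu>" for \<mu> \<nu>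
  proof -
    have "\<nu> * (f \<mu> \<bullet> f \<nu>) = \<mu> * (f \<mu> \<bullet> f \<nu>)"
      using inner_swap[of "f \<mu>" "f \<nu>"]
      unfolding fQ[OF E(1)] fQ[OF E(2)] inner_scaleR_left inner_scaleR_right .
    then show ?thesis using \<open>\<mu> \<noteq> \<nu>\<close> by simp
  qed
  have "pairwise orthogonal (f ` E)"
    unfolding pairwise_def orthogonal_def using orth by blast
  moreover have "0 \<notin> f ` E"
    using f0 by (auto simp: image_iff)
  ultimately have "independent (f ` E)"
    by (rule pairwise_orthogonal_independent)
  then have "finite (f ` E)"
    by (rule independent_imp_finite)
  then have "finite E"
    using inj by (rule finite_imageD)
  then show ?thesis
    unfolding E_def .
qed

text \<open>The form \<open>w \<bullet> (Q *v w)\<close> attains its minimum on the unit sphere of the range at an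
  eigenvector \<open>v\<close>: the first variation of the nonnegative form \<open>w \<bullet> (Q *v w) - m * (w \<bullet> w)\<close> at its
  zero \<open>v\<close> vanishes in every direction of the range, in particular in the direction
  \<open>Q *v v - m *\<^sub>R v\<close>. The minimum \<open>m\<close> is therefore an eigenvalue, nonzero because the range meets
  the kernel only in \<open>0\<close>.\<close>

lemma min_eigenvalue_Ran:
  assumes "Q \<noteq> 0"
  shows "0 < min_nonzero_eigenvalue Q"
    and "w \<in> Ran Q \<Longrightarrow> min_nonzero_eigenvalue Q * (w \<bullet> w) \<le> w \<bullet> (Q *v w)"
proof -
  let ?E = "{\<mu>. \<mu> \<noteq> 0 \<and> (\<exists>v. v \<noteq> 0 \<and> Q *v v = \<mu> *\<^sub>R v)}"
  let ?C = "sphere 0 1 \<inter> Ran Q"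
  have lam: "min_nonzero_eigenvalue Q = Min ?E"
    using assms by (simp add: min_nonzero_eigenvalue_def)
  obtain h where h: "Q *v h \<noteq> 0"
    using assms by (metis matrix_eq matrix_vector_mult_0)
  have "(1 / norm (Q *v h)) *\<^sub>R (Q *v h) \<in> ?C"
    using h subspace_scale[OF subspace_Ran mult_in_Ran] by simp
  then have ne: "?C \<noteq> {}" by blast
  have comp: "compact ?C"
    using closed_subspace[OF subspace_Ran] by (intro compact_Int_closed) auto
  have "continuous_on ?C (\<lambda>w. w \<bullet> (Q *v w))"
    by (intro continuous_intros matrix_vector_mult_linear_continuous_on)
  then obtain v where v: "v \<in> ?C" and min: "\<And>w. w \<in> ?C \<Longrightarrow> v \<bullet> (Q *v v) \<le> w \<bullet> (Q *v w)"
    using continuous_attains_inf[OF comp ne] by blast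
  define m where "m = v \<bullet> (Q *v v)"
  have vR: "v \<in> Ran Q" and v1: "v \<bullet> v = 1"
    using v by (auto simp: dot_square_norm)
  have form: "0 \<le> w \<bullet> (Q *v w) - m * (w \<bullet> w)" if "w \<in> Ran Q" for w
  proof (cases "w = 0")
    case False
    have "(1 / norm w) *\<^sub>R w \<in> ?C"
      using False that subspace_scale[OF subspace_Ran that] by simp
    then have "m \<le> ((1 / norm w) *\<^sub>R w) \<bullet> (Q *v ((1 / norm w) *\<^sub>R w))"
      using min m_def by blast
    also have "\<dots> = (w \<bullet> (Q *v w)) / (w \<bullet> w)"
      by (simp add: matrix_vector_mult_scaleR dot_square_norm power2_eq_square)
    finally show ?thesis
      using False by (simp add: field_simps)
  qed simp
  define g where "g = Q *v v - m *\<^sub>R v"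
  have gR: "g \<in> Ran Q"
    unfolding g_def by (intro subspace_diff[OF subspace_Ran] subspace_scale[OF subspace_Ran] vR) simp
  define C where "C = g \<bullet> (Q *v g) - m * (g \<bullet> g)"
  have var: "0 \<le> 2 * t * (g \<bullet> g) + t\<^sup>2 * C" for t
  proof -
    have "v + t *\<^sub>R g \<in> Ran Q"
      by (intro subspace_add[OF subspace_Ran] subspace_scale[OF subspace_Ran] vR gR)
    from form[OF this] have "0 \<le> (v + t *\<^sub>R g) \<bullet> (Q *v (v + t *\<^sub>R g)) - m * ((v + t *\<^sub>R g) \<bullet> (v + t *\<^sub>R g))" .
    also have "\<dots> = (v \<bullet> (Q *v v) - m * (v \<bullet> v)) + 2 * t * (g \<bullet> (Q *v v) - m * (g \<bullet> v)) + t\<^sup>2 * C"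
      using inner_swap[of v g]
      by (simp add: C_def matrix_vector_right_distrib matrix_vector_mult_scaleR inner_add_left
          inner_add_right inner_commute power2_eq_square algebra_simps)
    also have "g \<bullet> (Q *v v) - m * (g \<bullet> v) = g \<bullet> g"
      by (simp add: g_def inner_diff_right inner_diff_left algebra_simps)
    finally show ?thesis using v1 by (simp add: m_def)
  qed
  have "g \<bullet> g = 0"
    using var by (rule linear_term_zero)
  then have "g = 0" by simp
  then have eig: "Q *v v = m *\<^sub>R v" by (simp add: g_def)
  have vn: "v \<noteq> 0" using v1 by auto
  have "m \<noteq> 0"
    using eig Ran_kernel_trivial[OF vR] vn by auto
  then have mE: "m \<in> ?E" using eig vn by blast
  have "Min ?E \<in> ?E"
    using Min_in[OF finite_eigenvalues] mE by blast
  then obtain x where x: "Min ?E \<noteq> 0" "x \<noteq> 0" "Q *v x = Min ?E *\<^sub>R x" by blast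
  have "0 \<le> Min ?E"
    using x(3,2) by (rule eigenvalue_nonneg)
  then show "0 < min_nonzero_eigenvalue Q"
    unfolding lam using x(1) by linarith
  assume "w \<in> Ran Q"
  have "min_nonzero_eigenvalue Q * (w \<bullet> w) \<le> m * (w \<bullet> w)"
    unfolding lam by (intro mult_right_mono Min_le[OF finite_eigenvalues mE]) simp
  also have "\<dots> \<le> w \<bullet> (Q *v w)"
    using form[OF \<open>w \<in> Ran Q\<close>] by simp
  finally show "min_nonzero_eigenvalue Q * (w \<bullet> w) \<le> w \<bullet> (Q *v w)" .
qed

lemma min_eigenvalue_nonneg: "0 \<le> min_nonzero_eigenvalue Q"
proof (cases "Q = 0")
  case True
  then have "min_nonzero_eigenvalue Q = 0"
    unfolding min_nonzero_eigenvalue_def by (rule if_P)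
  then show ?thesis by simp
next
  case False
  then show ?thesis using min_eigenvalue_Ran(1) by simp
qed

lemma Ran_norm_bound:
  obtains M where "0 \<le> M" "\<And>w. w \<in> Ran Q \<Longrightarrow> norm w \<le> M * norm (Q *v w)"
proof (cases "Q = 0")
  case True
  then have "norm w \<le> 0 * norm (Q *v w)" if "w \<in> Ran Q" for w
    using that by (auto simp: Ran_def)
  then show ?thesis
    using that[of 0] by simp
next
  case False
  let ?m = "min_nonzero_eigenvalue Q"
  have "norm w \<le> (1 / ?m) * norm (Q *v w)" if "w \<in> Ran Q" for w
  proof (cases "w = 0")
    case w: False
    have "(?m * norm w) * norm w \<le> norm (Q *v w) * norm w"
      using min_eigenvalue_Ran(2)[OF False that] norm_cauchy_schwarz[of w "Q *v w"]
      by (simp add: dot_square_norm power2_eq_square algebra_simps)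
    then show ?thesis
      using w min_eigenvalue_Ran(1)[OF False] by (simp add: field_simps)
  qed simp
  then show ?thesis
    using that[of "1 / ?m"] min_eigenvalue_nonneg by simp
qed

text \<open>The curvature of \<open>Q\<close> along its range pays for a linear perturbation by a vector of the range:
  only the range component of \<open>v\<close> pairs with \<open>e\<close>, and that component is controlled by
  \<open>v \<bullet> (Q *v v)\<close>. This is why the factor \<open>sqrt (min_nonzero_eigenvalue Q)\<close> stands in the stopping
  criteria.\<close>

lemma perturbation_absorbed:
  assumes "e \<in> Ran Q" and "norm e \<le> sqrt (min_nonzero_eigenvalue Q) * t"
  shows "- (e \<bullet> v) - v \<bullet> (Q *v v) \<le> t\<^sup>2 / 4"
proof (cases "Q = 0")
  case True
  then show ?thesis using assms(1) by (auto simp: Ran_def)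
next
  case False
  let ?m = "min_nonzero_eigenvalue Q"
  note m = min_eigenvalue_Ran(1)[OF False]
  obtain y where y: "y \<in> Ran Q" "Q *v y = Q *v v" "\<And>h. h \<in> Ran Q \<Longrightarrow> h \<bullet> v = h \<bullet> y"
    using Ran_component[of v] by blast
  have "v \<bullet> (Q *v v) = (Q *v y) \<bullet> v"
    by (simp add: y(2) inner_commute)
  also have "\<dots> = y \<bullet> (Q *v y)"
    using y(3)[OF mult_in_Ran] by (simp add: inner_commute)
  finally have form: "?m * (norm y)\<^sup>2 \<le> v \<bullet> (Q *v v)"
    using min_eigenvalue_Ran(2)[OF False y(1)] by (simp add: dot_square_norm)
  have "- (e \<bullet> v) = - (e \<bullet> y)"
    using y(3)[OF assms(1)] by simp
  also have "\<dots> \<le> norm e * norm y"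
    using Cauchy_Schwarz_ineq2[of e y] by linarith
  also have "\<dots> \<le> (sqrt ?m * t) * norm y"
    by (intro mult_right_mono assms) simp
  also have "\<dots> \<le> t\<^sup>2 / 4 + (sqrt ?m * norm y)\<^sup>2"
    using zero_le_power2[of "t / 2 - sqrt ?m * norm y"]
    by (simp add: power2_diff algebra_simps power_divide)
  also have "(sqrt ?m * norm y)\<^sup>2 = ?m * (norm y)\<^sup>2"
    using m by (simp add: power_mult_distrib)
  finally show ?thesis using form by simp
qed

end

section \<open>Projections, minimizers over convex sets, and distances\<close>

lemma inner_self_le_zero: "v \<bullet> v \<le> 0 \<Longrightarrow> v = 0" for v :: "'a::real_inner"
  by (metis inner_gt_zero_iff linorder_not_le)

definition normal_cone :: "'a::real_inner set \<Rightarrow> 'a \<Rightarrow> 'a set" where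
  "normal_cone S p = {v. \<forall>y\<in>S. v \<bullet> (y - p) \<le> 0}"

lemma normal_coneD: "v \<in> normal_cone S p \<Longrightarrow> y \<in> S \<Longrightarrow> v \<bullet> (y - p) \<le> 0"
  by (simp add: normal_cone_def)

lemma normal_cone_monotone:
  assumes "v \<in> normal_cone S p" "v' \<in> normal_cone S p'" "p \<in> S" "p' \<in> S"
  shows "0 \<le> (v - v') \<bullet> (p - p')"
  using normal_coneD[OF assms(1,4)] normal_coneD[OF assms(2,3)]
  by (simp add: inner_diff_left inner_diff_right)

text \<open>Moving from the minimizer \<open>p\<close> a fraction \<open>t\<close> of the way to \<open>y\<close> changes \<open>F\<close> by at most
  \<open>t * (g \<bullet> (y - p))\<close> plus a term of order \<open>t\<^sup>2\<close>, and this change is nonnegative.\<close>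

lemma minimizer_normal_cone:
  fixes F :: "'a::real_inner \<Rightarrow> real"
  assumes "convex S" "p \<in> S" and min: "\<And>y. y \<in> S \<Longrightarrow> F p \<le> F y"
    and upper: "\<And>y. F y \<le> F p + g \<bullet> (y - p) + C * (norm (y - p))\<^sup>2"
  shows "- g \<in> normal_cone S p"
  unfolding normal_cone_def
proof (intro CollectI ballI)
  fix y assume "y \<in> S"
  have t: "- (g \<bullet> (y - p)) \<le> t * (C * (norm (y - p))\<^sup>2)" if "0 < t" "t < 1" for t
  proof -
    have "p + t *\<^sub>R (y - p) \<in> S"
      using convexD_alt[OF assms(1,2) \<open>y \<in> S\<close>, of t] that by (simp add: algebra_simps)
    then have "F p \<le> F p + g \<bullet> (t *\<^sub>R (y - p)) + C * (norm (t *\<^sub>R (y - p)))\<^sup>2"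
      using min[of "p + t *\<^sub>R (y - p)"] upper[of "p + t *\<^sub>R (y - p)"] by simp
    then have "0 \<le> t * (g \<bullet> (y - p)) + C * (t * norm (y - p))\<^sup>2"
      using that by simp
    then have "t * (- (g \<bullet> (y - p))) \<le> t * (t * (C * (norm (y - p))\<^sup>2))"
      by (simp add: power_mult_distrib power2_eq_square mult_ac)
    then show ?thesis
      using that by (simp only: mult_le_cancel_left_pos)
  qed
  have "((\<lambda>t. t * (C * (norm (y - p))\<^sup>2)) \<longlongrightarrow> 0 * (C * (norm (y - p))\<^sup>2)) (at_right (0::real))"
    by (intro tendsto_intros)
  moreover have "eventually (\<lambda>t::real. - (g \<bullet> (y - p)) \<le> t * (C * (norm (y - p))\<^sup>2)) (at_right 0)"
    using t by (auto simp: eventually_at_right_field intro!: exI[of _ 1])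
  ultimately have "- (g \<bullet> (y - p)) \<le> 0 * (C * (norm (y - p))\<^sup>2)"
    by (rule tendsto_lowerbound) simp
  then show "- g \<bullet> (y - p) \<le> 0" by simp
qed

text \<open>The function is the supremum of the affine functions \<open>v \<mapsto> 2 * (v \<bullet> y) - (norm y)\<^sup>2\<close> over
  \<open>y \<in> S\<close>, attained at the projection of \<open>v\<close>. Using the maximizer of one point at the other one
  bounds its increments from both sides, and the projection is nonexpansive.\<close>

lemma GDERIV_norm_minus_dist:
  fixes S :: "'a::euclidean_space set"
  assumes "convex S" "closed S" "S \<noteq> {}"
  shows "GDERIV (\<lambda>v. (norm v)\<^sup>2 - (norm (v - closest_point S v))\<^sup>2) a :> 2 *\<^sub>R closest_point S a"
proof -
  let ?P = "closest_point S"
  define \<phi> where "\<phi> v = (norm v)\<^sup>2 - (norm (v - ?P v))\<^sup>2" for v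
  have \<phi>: "\<phi> v = 2 * (v \<bullet> ?P v) - ?P v \<bullet> ?P v" for v
    by (simp add: \<phi>_def power2_norm_eq_inner inner_diff_left inner_diff_right inner_commute)
  have P: "?P v \<in> S" for v
    using assms by (simp add: closest_point_in_set)
  have lower: "2 * (v \<bullet> y) - y \<bullet> y \<le> \<phi> v" if "y \<in> S" for v y
  proof -
    have "norm (v - ?P v) \<le> norm (v - y)"
      using closest_point_le[OF assms(2) that, of v] by (simp add: dist_norm)
    then have "(norm (v - ?P v))\<^sup>2 \<le> (norm (v - y))\<^sup>2"
      by (simp add: power_mono)
    then show ?thesis
      by (simp add: \<phi>_def power2_norm_eq_inner inner_diff_left inner_diff_right inner_commute)
  qed
  have err: "norm (\<phi> v - \<phi> a - (v - a) \<bullet> (2 *\<^sub>R ?P a)) \<le> 2 * (norm (v - a))\<^sup>2" for v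
  proof -
    have 1: "0 \<le> \<phi> v - \<phi> a - (v - a) \<bullet> (2 *\<^sub>R ?P a)"
      using lower[OF P[of a], of v] \<phi>[of a] by (simp add: inner_diff_left algebra_simps)
    have "\<phi> v - \<phi> a - (v - a) \<bullet> (2 *\<^sub>R ?P a) \<le> 2 * ((v - a) \<bullet> (?P v - ?P a))"
      using lower[OF P[of v], of a] \<phi>[of v]
      by (simp add: inner_diff_left inner_diff_right algebra_simps)
    also have "\<dots> \<le> 2 * (norm (v - a) * norm (?P v - ?P a))"
      using norm_cauchy_schwarz[of "v - a"] by simp
    also have "\<dots> \<le> 2 * (norm (v - a) * norm (v - a))"
      using closest_point_lipschitz[OF assms, of v a]
      by (intro mult_left_mono) (auto simp: dist_norm)
    finally show ?thesis using 1 by (simp add: power2_eq_square)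
  qed
  have "(\<phi> has_derivative (\<lambda>h. h \<bullet> (2 *\<^sub>R ?P a))) (at a)"
  proof (rule has_derivativeI_sandwich[of 1])
    show "bounded_linear (\<lambda>h. h \<bullet> (2 *\<^sub>R ?P a))"
      by (rule bounded_linear_inner_left)
    show "norm (\<phi> v - \<phi> a - (v - a) \<bullet> (2 *\<^sub>R ?P a)) / norm (v - a) \<le> 2 * norm (v - a)"
      if "v \<noteq> a" for v
      using err[of v] that by (simp add: divide_simps power2_eq_square)
    have "((\<lambda>v. 2 * norm (v - a)) \<longlongrightarrow> 2 * norm (a - a)) (at a)"
      by (intro tendsto_intros)
    then show "((\<lambda>v. 2 * norm (v - a)) \<longlongrightarrow> 0) (at a)" by simp
  qed simp
  then show ?thesis
    unfolding gderiv_def \<phi>_def .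
qed

lemma gradient_eqI:
  assumes "GDERIV f x :> D"
  shows "gradient f x = D"
  unfolding gradient_def
proof (rule the_equality)
  fix D' assume "GDERIV f x :> D'"
  then have "(\<lambda>h. h \<bullet> D') = (\<lambda>h. h \<bullet> D)"
    using assms unfolding gderiv_def by (rule has_derivative_unique)
  then have "\<forall>h. h \<bullet> D' = h \<bullet> D"
    by (intro allI) (rule fun_cong)
  then show "D' = D"
    using vector_eq_ldot by blast
qed fact

lemma pt_dist_le: "y \<in> T \<Longrightarrow> pt_dist x T \<le> ereal (norm (x - y))"
  unfolding pt_dist_def by (rule INF_lower)

lemma pt_dist_0_le: "y \<in> T \<Longrightarrow> pt_dist 0 T \<le> ereal (norm y)"
  using pt_dist_le[of y T 0] by simp

lemma pt_dist_attained:
  fixes T :: "'a::euclidean_space set"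
  assumes "closed T" "T \<noteq> {}"
  obtains y where "y \<in> T" "pt_dist x T = ereal (norm (x - y))"
proof -
  obtain y where y: "y \<in> T" "\<And>y'. y' \<in> T \<Longrightarrow> dist x y \<le> dist x y'"
    using distance_attains_inf[OF assms, of x] by blast
  then have "pt_dist x T = ereal (norm (x - y))"
    unfolding pt_dist_def by (intro antisym INF_lower INF_greatest) (auto simp: dist_norm)
  then show ?thesis using that y(1) by blast
qed

text \<open>Subtracting the partial sums of \<open>\<epsilon>\<close> turns \<open>\<alpha>\<close> into a decreasing sequence bounded below.\<close>

lemma quasi_decreasing_convergent:
  fixes \<alpha> \<epsilon> :: "nat \<Rightarrow> real"
  assumes "\<And>k. 0 \<le> \<alpha> k" "\<And>k. \<alpha> (Suc k) \<le> \<alpha> k + \<epsilon> k" "summable \<epsilon>"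
  shows "convergent \<alpha>"
proof -
  define s where "s k = (\<Sum>i<k. \<epsilon> i)" for k
  have s: "convergent s"
    unfolding s_def using assms(3) by (simp add: summable_iff_convergent)
  then obtain B where B: "\<And>k. norm (s k) \<le> B"
    using convergent_imp_Bseq BseqE by metis
  have "decseq (\<lambda>k. \<alpha> k - s k)"
    by (rule decseq_SucI) (use assms(2) in \<open>simp add: s_def algebra_simps\<close>)
  moreover have "- B \<le> \<alpha> k - s k" for k
    using assms(1)[of k] B[of k] by (simp add: abs_le_iff)
  ultimately obtain L where "(\<lambda>k. \<alpha> k - s k) \<longlonglongrightarrow> L"
    using decseq_convergent[of "\<lambda>k. \<alpha> k - s k" "- B"] by blast
  then have "convergent (\<lambda>k. (\<alpha> k - s k) + s k)"
    using s by (intro convergent_add) (auto simp: convergent_def)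
  then show ?thesis by simp
qed

section \<open>Optimality in the primal and in the dual problem\<close>

locale constrained_qp = psd_matrix Q for Q :: "real^'n^'n" +
  fixes c :: "real^'n" and S :: "(real^'n) set"
  assumes convex_S: "convex S" and compact_S: "compact S" and S_ne: "S \<noteq> {}"
begin

definition objective :: "real^'n \<Rightarrow> real" where
  "objective y = 1/2 * (y \<bullet> (Q *v y)) + c \<bullet> y"

lemma closed_S: "closed S"
  using compact_S by (rule compact_imp_closed)

lemma objective_expand:
  "objective y = objective p + (Q *v p + c) \<bullet> (y - p) + 1/2 * ((y - p) \<bullet> (Q *v (y - p)))"
proof -
  have "(y - p) \<bullet> (Q *v (y - p)) = y \<bullet> (Q *v y) - 2 * (y \<bullet> (Q *v p)) + p \<bullet> (Q *v p)"
    using inner_swap[of p y]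
    by (simp add: matrix_vector_mult_diff_distrib inner_diff_left inner_diff_right inner_commute)
  moreover have "(Q *v p + c) \<bullet> (y - p) = y \<bullet> (Q *v p) - p \<bullet> (Q *v p) + c \<bullet> y - c \<bullet> p"
    by (simp add: inner_diff_right inner_add_left inner_add_right inner_commute)
  ultimately show ?thesis
    unfolding objective_def by linarith
qed

lemma objective_mono_tangent: "objective p + (Q *v p + c) \<bullet> (y - p) \<le> objective y"
  using objective_expand[of y p] psd[of "y - p"] by simp

lemma objective_continuous: "continuous_on A objective"
  unfolding objective_def
  by (intro continuous_intros matrix_vector_mult_linear_continuous_on)

lemma objective_upper:
  "\<exists>C. \<forall>p y. objective y \<le> objective p + (Q *v p + c) \<bullet> (y - p) + C * (norm (y - p))\<^sup>2"
proof -
  obtain B where B: "\<And>h. norm (Q *v h) \<le> norm h * B"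
    using bounded_linear.bounded[OF matrix_vector_mul_bounded_linear[of Q]] by blast
  have "h \<bullet> (Q *v h) \<le> B * (norm h)\<^sup>2" for h
  proof -
    have "h \<bullet> (Q *v h) \<le> norm h * norm (Q *v h)"
      by (rule norm_cauchy_schwarz)
    also have "\<dots> \<le> norm h * (norm h * B)"
      by (intro mult_left_mono B) simp
    finally show ?thesis by (simp add: power2_eq_square mult_ac)
  qed
  then have "objective y \<le> objective p + (Q *v p + c) \<bullet> (y - p) + (B / 2) * (norm (y - p))\<^sup>2" for p y
    using objective_expand[of y p] by (simp add: field_simps)
  then show ?thesis by blast
qed

lemma primal_obj_in: "y \<in> S \<Longrightarrow> primal_obj Q c S y = ereal (objective y)"
  by (simp add: primal_obj_def indicator_fn_def objective_def)

lemma primal_obj_out: "y \<notin> S \<Longrightarrow> primal_obj Q c S y = \<infinity>"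
  by (simp add: primal_obj_def indicator_fn_def)

lemma primal_solutions_eq:
  "primal_solutions Q c S = {p \<in> S. \<forall>y\<in>S. objective p \<le> objective y}"
proof (intro set_eqI iffI)
  fix p assume "p \<in> primal_solutions Q c S"
  then have p: "primal_obj Q c S p \<le> primal_obj Q c S y" for y
    by (simp add: primal_solutions_def)
  obtain y0 where "y0 \<in> S" using S_ne by blast
  then have "p \<in> S"
    using p[of y0] primal_obj_in[of y0] primal_obj_out[of p] by (cases "p \<in> S") auto
  moreover have "objective p \<le> objective y" if "y \<in> S" for y
    using p[of y] \<open>p \<in> S\<close> that by (simp add: primal_obj_in)
  ultimately show "p \<in> {p \<in> S. \<forall>y\<in>S. objective p \<le> objective y}" by blast
next
  fix p assume "p \<in> {p \<in> S. \<forall>y\<in>S. objective p \<le> objective y}"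
  then have "primal_obj Q c S p \<le> primal_obj Q c S y" for y
    by (cases "y \<in> S") (auto simp: primal_obj_in primal_obj_out)
  then show "p \<in> primal_solutions Q c S"
    by (simp add: primal_solutions_def)
qed

lemma primal_solution_iff:
  "p \<in> primal_solutions Q c S \<longleftrightarrow> p \<in> S \<and> - (Q *v p + c) \<in> normal_cone S p"
proof
  assume p: "p \<in> primal_solutions Q c S"
  obtain C where C: "\<And>p y. objective y \<le> objective p + (Q *v p + c) \<bullet> (y - p) + C * (norm (y - p))\<^sup>2"
    using objective_upper by blast
  have "- (Q *v p + c) \<in> normal_cone S p"
    by (rule minimizer_normal_cone[where F = objective and C = C])
      (use p C convex_S in \<open>auto simp: primal_solutions_eq\<close>)
  then show "p \<in> S \<and> - (Q *v p + c) \<in> normal_cone S p"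
    using p by (simp add: primal_solutions_eq)
next
  assume p: "p \<in> S \<and> - (Q *v p + c) \<in> normal_cone S p"
  have "objective p \<le> objective y" if "y \<in> S" for y
    using objective_mono_tangent[of p y] normal_coneD[of "- (Q *v p + c)" S p y] p that
    unfolding inner_minus_left by linarith
  then show "p \<in> primal_solutions Q c S"
    using p by (simp add: primal_solutions_eq)
qed

lemma primal_solutions_nonempty: "primal_solutions Q c S \<noteq> {}"
  using continuous_attains_inf[OF compact_S S_ne objective_continuous]
  by (auto simp: primal_solutions_eq)

lemma primal_solutions_closed: "closed (primal_solutions Q c S)"
proof -
  obtain p where p: "p \<in> primal_solutions Q c S"
    using primal_solutions_nonempty by blast
  have "primal_solutions Q c S = S \<inter> {y. objective y \<le> objective p}"
    using p by (force simp: primal_solutions_eq)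
  moreover have "closed {y. objective y \<le> objective p}"
    by (intro closed_Collect_le objective_continuous continuous_on_const)
  ultimately show ?thesis
    using closed_S by (simp add: closed_Int)
qed

lemma T_f_zeros_eq: "T_f_zeros Q c S = primal_solutions Q c S"
  by (simp add: T_f_zeros_def T_f_def subdifferential_def primal_solutions_def flip: zero_ereal_def)

lemma T_f_member:
  assumes "p \<in> S" "v - (Q *v p + c) \<in> normal_cone S p"
  shows "v \<in> T_f Q c S p"
proof -
  have "primal_obj Q c S p + ereal (v \<bullet> (y - p)) \<le> primal_obj Q c S y" for y
  proof (cases "y \<in> S")
    case True
    have "objective p + v \<bullet> (y - p) \<le> objective y"
      using normal_coneD[OF assms(2) True] objective_mono_tangent[of p y]
      unfolding inner_diff_left[of v] by linarith
    then show ?thesis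
      using True assms(1) by (simp add: primal_obj_in)
  qed (simp add: primal_obj_out)
  then show ?thesis
    by (simp add: T_f_def subdifferential_def)
qed

lemma proximal_point_exists:
  assumes "0 < s"
  obtains p where "p \<in> S" "(1 / s) *\<^sub>R (x - p) - (Q *v p + c) \<in> normal_cone S p"
proof -
  define F where "F y = objective y + 1 / (2 * s) * (norm (y - x))\<^sup>2" for y
  have "continuous_on S F"
    unfolding F_def by (intro continuous_intros objective_continuous)
  then obtain p where p: "p \<in> S" "\<And>y. y \<in> S \<Longrightarrow> F p \<le> F y"
    using continuous_attains_inf[OF compact_S S_ne] by blast
  obtain C where C: "\<And>p y. objective y \<le> objective p + (Q *v p + c) \<bullet> (y - p) + C * (norm (y - p))\<^sup>2"
    using objective_upper by blast
  have "F y \<le> F p + ((Q *v p + c) - (1 / s) *\<^sub>R (x - p)) \<bullet> (y - p)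
      + (C + 1 / (2 * s)) * (norm (y - p))\<^sup>2" for y
  proof -
    have "(norm (y - x))\<^sup>2 = (norm (p - x))\<^sup>2 - 2 * ((x - p) \<bullet> (y - p)) + (norm (y - p))\<^sup>2"
      by (simp add: power2_norm_eq_inner inner_diff_left inner_diff_right inner_commute)
    then have "1 / (2 * s) * (norm (y - x))\<^sup>2 = 1 / (2 * s) * (norm (p - x))\<^sup>2
        - (1 / s) * ((x - p) \<bullet> (y - p)) + 1 / (2 * s) * (norm (y - p))\<^sup>2"
      using assms by (simp add: field_simps)
    then show ?thesis
      using C[of y p]
      unfolding F_def inner_diff_left[of "Q *v p + c"] inner_scaleR_left distrib_right by linarith
  qed
  then have "- ((Q *v p + c) - (1 / s) *\<^sub>R (x - p)) \<in> normal_cone S p"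
    using p convex_S by (intro minimizer_normal_cone[where F = F and C = "C + 1 / (2 * s)"]) auto
  then show ?thesis
    using that[OF p(1)] by simp
qed

lemma conjugate_ge: "y \<in> S \<Longrightarrow> ereal (v \<bullet> y) \<le> convex_conjugate (indicator_fn S) v"
  unfolding convex_conjugate_def
  by (rule SUP_upper2[of y]) (auto simp: indicator_fn_def)

lemma conjugate_normal:
  assumes "p \<in> S" "v \<in> normal_cone S p"
  shows "convex_conjugate (indicator_fn S) v = ereal (v \<bullet> p)"
proof (rule antisym)
  show "convex_conjugate (indicator_fn S) v \<le> ereal (v \<bullet> p)"
    unfolding convex_conjugate_def
  proof (rule SUP_least)
    fix y show "ereal (v \<bullet> y) - indicator_fn S y \<le> ereal (v \<bullet> p)"
      using normal_coneD[OF assms(2), of y]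
      by (cases "y \<in> S") (auto simp: indicator_fn_def inner_diff_right)
  qed
qed (rule conjugate_ge[OF assms(1)])

lemma dual_obj_finite:
  obtains D where "dual_obj Q S v b = ereal D"
proof -
  have "continuous_on S (\<lambda>y. b \<bullet> y)"
    by (intro continuous_intros)
  then obtain p where p: "p \<in> S" "\<And>y. y \<in> S \<Longrightarrow> b \<bullet> y \<le> b \<bullet> p"
    using continuous_attains_sup[OF compact_S S_ne] by blast
  then have "b \<in> normal_cone S p"
    by (simp add: normal_cone_def inner_diff_right)
  then have "dual_obj Q S v b = ereal (1/2 * (v \<bullet> (Q *v v)) + b \<bullet> p)"
    by (simp add: dual_obj_def conjugate_normal[OF p(1)])
  then show ?thesis by (rule that)
qed

text \<open>Completing the square shows that the dual objective at \<open>(v, - (Q *v v + c))\<close> exceeds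
  \<open>- p \<bullet> (Q *v p) / 2 - c \<bullet> p\<close> by at least \<open>(v - p) \<bullet> (Q *v (v - p)) / 2\<close>, so any \<open>v\<close> of the range
  with the same image as a primal solution \<open>p\<close> is optimal.\<close>

lemma dual_solutionI:
  assumes p: "p \<in> primal_solutions Q c S" and v: "v \<in> Ran Q" "Q *v v = Q *v p"
  shows "(v, - (Q *v p + c)) \<in> dual_solutions Q c S"
proof -
  have pS: "p \<in> S" and N: "- (Q *v p + c) \<in> normal_cone S p"
    using p by (auto simp: primal_solution_iff)
  have "v \<bullet> (Q *v v) = p \<bullet> (Q *v p)"
    unfolding v(2) inner_swap[of v p] by (rule inner_commute)
  then have val: "dual_obj Q S v (- (Q *v p + c)) = ereal (- (1/2 * (p \<bullet> (Q *v p))) - c \<bullet> p)"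
    unfolding dual_obj_def conjugate_normal[OF pS N] inner_minus_left inner_add_left
    by (simp add: inner_commute)
  have "dual_obj Q S v (- (Q *v p + c)) \<le> dual_obj Q S v' b'" if "dual_feasible Q c v' b'" for v' b'
  proof -
    have "b' = (Q *v v' + b' + c) - (Q *v v' + c)" by simp
    then have b': "b' = - (Q *v v' + c)"
      using that unfolding dual_feasible_def by simp
    have "- (1/2 * (p \<bullet> (Q *v p))) - c \<bullet> p \<le> 1/2 * (v' \<bullet> (Q *v v')) + b' \<bullet> p"
      using psd[of "v' - p"] inner_swap[of p v']
      by (simp add: b' matrix_vector_mult_diff_distrib inner_diff_left inner_diff_right
          inner_commute)
    then have "dual_obj Q S v (- (Q *v p + c)) \<le> ereal (1/2 * (v' \<bullet> (Q *v v'))) + ereal (b' \<bullet> p)"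
      unfolding val by simp
    also have "\<dots> \<le> dual_obj Q S v' b'"
      unfolding dual_obj_def by (intro add_left_mono conjugate_ge pS)
    finally show ?thesis .
  qed
  then show ?thesis
    using v by (auto simp: dual_solutions_def dual_feasible_def)
qed

lemma lagrangian_in:
  "v \<in> Ran Q \<Longrightarrow> lagrangian Q c S v b y = dual_obj Q S v b - ereal (y \<bullet> (Q *v v + b + c))"
  by (simp add: lagrangian_def)

text \<open>The dual objective is finite because \<open>S\<close> is compact, so the Lagrangian is affine in the
  multiplier with slope \<open>- (Q *v v + b + c)\<close>. Maximality in the multiplier forces feasibility, and
  on feasible pairs the Lagrangian is the dual objective.\<close>

lemma T_l_zeros_dual_solution:
  assumes "(v, b, y) \<in> T_l_zeros Q c S"
  shows "(v, b) \<in> dual_solutions Q c S"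
proof -
  have sub: "lagrangian Q c S v b y \<le> lagrangian Q c S v' b' y" for v' b'
    using assms
    by (auto simp: T_l_zeros_def T_l_def subdifferential_def zero_prod_def simp flip: zero_ereal_def)
  have sup: "lagrangian Q c S v b y' \<le> lagrangian Q c S v b y" for y'
    using assms
    by (auto simp: T_l_zeros_def T_l_def superdifferential_def zero_prod_def simp flip: zero_ereal_def)
  have v: "v \<in> Ran Q"
  proof (rule ccontr)
    assume "v \<notin> Ran Q"
    then have "lagrangian Q c S v b y = \<infinity>"
      by (simp add: lagrangian_def)
    moreover obtain D where "dual_obj Q S 0 0 = ereal D"
      by (rule dual_obj_finite)
    then have "lagrangian Q c S 0 0 y = ereal (D - y \<bullet> c)"
      using subspace_0[OF subspace_Ran] by (simp add: lagrangian_in)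
    ultimately show False
      using sub[of 0 0] by simp
  qed
  define g where "g = Q *v v + b + c"
  obtain D where D: "dual_obj Q S v b = ereal D"
    by (rule dual_obj_finite)
  have "D - (y - g) \<bullet> g \<le> D - y \<bullet> g"
    using sup[of "y - g"] by (simp add: lagrangian_in[OF v] D g_def)
  then have "g = 0"
    by (intro inner_self_le_zero) (simp add: inner_diff_left)
  then have feas: "dual_feasible Q c v b"
    using v by (simp add: dual_feasible_def g_def)
  have "dual_obj Q S v b \<le> dual_obj Q S v' b'" if "dual_feasible Q c v' b'" for v' b'
    using sub[of v' b'] that feas
    by (simp add: lagrangian_in dual_feasible_def flip: zero_ereal_def)
  then show ?thesis
    using feas by (simp add: dual_solutions_def)
qed

text \<open>\<open>b \<in> normal_cone S p\<close> means that \<open>p\<close> is a subgradient of the conjugate at \<open>b\<close>; this makes the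
  middle component of the residual \<open>0\<close>.\<close>

lemma T_l_member:
  assumes p: "p \<in> S" "b \<in> normal_cone S p" and v: "v \<in> Ran Q"
  shows "(Q *v v - Q *v p, 0, Q *v v + b + c) \<in> T_l Q c S (v, b, p)"
proof -
  define D where "D = 1/2 * (v \<bullet> (Q *v v)) + b \<bullet> p"
  have D: "dual_obj Q S v b = ereal D"
    by (simp add: dual_obj_def conjugate_normal[OF p] D_def)
  have "lagrangian Q c S v b p + ereal ((Q *v v - Q *v p, 0) \<bullet> ((v', b') - (v, b)))
      \<le> lagrangian Q c S v' b' p" for v' b'
  proof (cases "v' \<in> Ran Q")
    case True
    obtain D' where D': "dual_obj Q S v' b' = ereal D'"
      by (rule dual_obj_finite)
    have "ereal (1/2 * (v' \<bullet> (Q *v v'))) + ereal (b' \<bullet> p) \<le> ereal D'"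
      unfolding D'[symmetric] dual_obj_def by (intro add_left_mono conjugate_ge p)
    then have "D - p \<bullet> (Q *v v + b + c) + (Q *v v - Q *v p) \<bullet> (v' - v) \<le> D' - p \<bullet> (Q *v v' + b' + c)"
      using psd[of "v' - v"] inner_swap[of v v'] inner_swap[of p v] inner_swap[of p v']
      by (simp add: D_def matrix_vector_mult_diff_distrib inner_diff_left inner_diff_right
          inner_add_right inner_commute)
    then show ?thesis
      by (simp add: lagrangian_in v True D D' inner_Pair)
  qed (simp add: lagrangian_def)
  moreover have "lagrangian Q c S v b y
      \<le> lagrangian Q c S v b p + ereal (- ((Q *v v + b + c) \<bullet> (y - p)))" for y
  proof -
    define g where "g = Q *v v + b + c"
    have "D - y \<bullet> g \<le> D - p \<bullet> g + - (g \<bullet> (y - p))"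
      by (simp add: inner_diff_right inner_commute)
    then show ?thesis
      by (simp add: lagrangian_in v D g_def)
  qed
  ultimately show ?thesis
    by (auto simp: T_l_def subdifferential_def superdifferential_def)
qed

text \<open>A step from \<open>x\<close> that ends at \<open>p\<close> with gradient residual \<open>e\<close> is compared with an exact
  proximal step from \<open>x'\<close> to \<open>y\<close>. Monotonicity of the normal cone leaves the curvature term
  \<open>(p - y) \<bullet> (Q *v (p - y))\<close>, which absorbs \<open>e\<close>. With \<open>x' = x\<close> the estimate measures the
  inexactness of the step; with \<open>x' = y\<close> a primal solution it yields quasi-Fejer monotonicity.\<close>

lemma inexact_proximal_step:
  assumes p: "p \<in> S" "(1 / s) *\<^sub>R (x - p) - e - (Q *v p + c) \<in> normal_cone S p"
    and y: "y \<in> S" "(1 / s) *\<^sub>R (x' - y) - (Q *v y + c) \<in> normal_cone S y"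
    and s: "0 < s" and e: "e \<in> Ran Q" "norm e \<le> sqrt (min_nonzero_eigenvalue Q) * t"
  shows "(norm (p - y))\<^sup>2 \<le> (x - x') \<bullet> (p - y) + s * t\<^sup>2 / 4"
proof -
  let ?v = "p - y"
  have "0 \<le> (((1 / s) *\<^sub>R (x - p) - e - (Q *v p + c)) - ((1 / s) *\<^sub>R (x' - y) - (Q *v y + c))) \<bullet> ?v"
    by (rule normal_cone_monotone[OF p(2) y(2) p(1) y(1)])
  also have "((1 / s) *\<^sub>R (x - p) - e - (Q *v p + c)) - ((1 / s) *\<^sub>R (x' - y) - (Q *v y + c))
      = (1 / s) *\<^sub>R ((x - x') - ?v) - e - Q *v ?v"
    by (simp add: matrix_vector_mult_diff_distrib algebra_simps)
  also have "\<dots> \<bullet> ?v = (1 / s) * ((x - x') \<bullet> ?v - ?v \<bullet> ?v) - (e \<bullet> ?v) - ?v \<bullet> (Q *v ?v)"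
    unfolding inner_diff_left[of _ _ ?v] inner_scaleR_left by (simp only: inner_commute)
  finally have "(1 / s) * (?v \<bullet> ?v - (x - x') \<bullet> ?v) \<le> t\<^sup>2 / 4"
    using perturbation_absorbed[OF e, of ?v] by (simp add: right_diff_distrib)
  then have "?v \<bullet> ?v - (x - x') \<bullet> ?v \<le> s * t\<^sup>2 / 4"
    using s by (simp add: field_simps)
  then show ?thesis
    by (simp add: power2_norm_eq_inner)
qed

lemma gradient_alm_psi:
  assumes "0 < s"
  shows "gradient (alm_psi Q c S s x) v = Q *v v - Q *v closest_point S (alm_u Q c s x v)"
proof (rule gradient_eqI)
  let ?u = "alm_u Q c s x"
  let ?P = "closest_point S (?u v)"
  note lin = bounded_linear.has_derivative[OF matrix_vector_mul_bounded_linear[of Q] has_derivative_ident]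
  have u: "(?u has_derivative (\<lambda>h. - (s *\<^sub>R (Q *v h)))) (at v)"
    unfolding alm_u_def by (rule derivative_eq_intros lin refl | simp)+
  have env: "((\<lambda>y. (norm y)\<^sup>2 - (norm (y - closest_point S y))\<^sup>2) has_derivative (\<lambda>h. h \<bullet> (2 *\<^sub>R ?P))) (at (?u v))"
    using GDERIV_norm_minus_dist[OF convex_S closed_S S_ne, of "?u v"] unfolding gderiv_def .
  have quad: "((\<lambda>y. y \<bullet> (Q *v y)) has_derivative (\<lambda>h. 2 * (h \<bullet> (Q *v v)))) (at v)"
    using has_derivative_inner[OF has_derivative_ident lin, of v UNIV] inner_swap[of v]
    by (simp add: inner_commute)
  have "(alm_psi Q c S s x has_derivative
      (\<lambda>h. 1/2 * (2 * (h \<bullet> (Q *v v))) + 1 / (2 * s) * ((- (s *\<^sub>R (Q *v h))) \<bullet> (2 *\<^sub>R ?P)) - 0)) (at v)"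
    unfolding alm_psi_def
    by (intro has_derivative_diff has_derivative_add has_derivative_const
        bounded_linear.has_derivative[OF bounded_linear_mult_right] quad
        has_derivative_compose[OF u env])
  also have "(\<lambda>h. 1/2 * (2 * (h \<bullet> (Q *v v))) + 1 / (2 * s) * ((- (s *\<^sub>R (Q *v h))) \<bullet> (2 *\<^sub>R ?P)) - 0)
      = (\<lambda>h. h \<bullet> (Q *v v - Q *v ?P))"
    using assms by (intro ext) (simp add: inner_diff_right inner_swap)
  finally show "GDERIV (alm_psi Q c S s x) v :> Q *v v - Q *v ?P"
    unfolding gderiv_def .
qed

lemma error_bound_f_at:
  assumes "error_bound_f Q c S r \<kappa>" "0 \<le> \<kappa>" "p \<in> S" "v - (Q *v p + c) \<in> normal_cone S p"
    and "pt_dist p (primal_solutions Q c S) \<le> ereal r"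
  shows "pt_dist p (primal_solutions Q c S) \<le> ereal (\<kappa> * norm v)"
proof -
  have "pt_dist p (primal_solutions Q c S) \<le> ereal \<kappa> * pt_dist 0 (T_f Q c S p)"
    using assms(1,5) by (simp add: error_bound_f_def T_f_zeros_eq)
  also have "\<dots> \<le> ereal \<kappa> * ereal (norm v)"
    using assms(2) by (intro ereal_mult_left_mono pt_dist_0_le T_f_member assms(3,4)) simp
  finally show ?thesis by simp
qed

lemma dual_solution_form:
  assumes "dual_solutions Q c S = {(wstar, zstar)}" "p \<in> primal_solutions Q c S"
  shows "wstar \<in> Ran Q" "Q *v wstar = Q *v p" "zstar = - (Q *v p + c)"
proof -
  obtain v where v: "v \<in> Ran Q" "Q *v v = Q *v p"
    using Ran_component[of p] by blast
  have "(v, - (Q *v p + c)) = (wstar, zstar)"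
    using dual_solutionI[OF assms(2) v] assms(1) by simp
  then show "wstar \<in> Ran Q" "Q *v wstar = Q *v p" "zstar = - (Q *v p + c)"
    using v by auto
qed

lemma dual_distance_near:
  assumes dual: "dual_solutions Q c S = {(wstar, zstar)}"
    and eb: "error_bound_l Q c S r (wstar, zstar, pstar) \<kappa>" "0 \<le> \<kappa>"
    and p: "p \<in> S" "b \<in> normal_cone S p" and v: "v \<in> Ran Q"
    and near: "norm ((v, b, p) - (wstar, zstar, pstar)) \<le> r"
  shows "norm ((v, b) - (wstar, zstar))
    \<le> \<kappa> * sqrt ((norm (Q *v v - Q *v p))\<^sup>2 + (norm (Q *v v + b + c))\<^sup>2)"
proof -
  have "ereal (norm ((v, b) - (wstar, zstar))) \<le> pt_dist (v, b, p) (T_l_zeros Q c S)"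
    unfolding pt_dist_def
  proof (rule INF_greatest)
    fix q assume q: "q \<in> T_l_zeros Q c S"
    obtain v' b' p' where q': "q = (v', b', p')" by (cases q)
    have "(v', b') = (wstar, zstar)"
      using T_l_zeros_dual_solution q dual unfolding q' by blast
    moreover have "norm (v - v', b - b') \<le> norm (v - v', b - b', p - p')"
      by (simp add: norm_Pair)
    ultimately show "ereal (norm ((v, b) - (wstar, zstar))) \<le> ereal (norm ((v, b, p) - q))"
      by (simp add: q')
  qed
  also have "\<dots> \<le> ereal \<kappa> * pt_dist 0 (T_l Q c S (v, b, p))"
    using eb near by (simp add: error_bound_l_def)
  also have "\<dots> \<le> ereal \<kappa> * ereal (norm (Q *v v - Q *v p, 0 :: real^'n, Q *v v + b + c))"
    using eb(2) by (intro ereal_mult_left_mono pt_dist_0_le T_l_member p v) simp_all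
  finally show ?thesis
    by (simp add: norm_Pair)
qed

text \<open>Also away from the base point of the second error bound, the first one controls the dual
  variables: \<open>(Q *v v + b + c) - (Q *v v - Q *v p)\<close> is a subgradient of the primal objective at
  \<open>p\<close>, so it bounds the distance of \<open>p\<close> to the solution set, on which \<open>Q\<close> is constant.\<close>

lemma dual_distance_far:
  "\<exists>K :: real \<Rightarrow> real. \<forall>\<kappa> r wstar zstar v b p.
    0 \<le> \<kappa> \<longrightarrow> error_bound_f Q c S r \<kappa> \<longrightarrow> dual_solutions Q c S = {(wstar, zstar)} \<longrightarrow>
    p \<in> S \<longrightarrow> b \<in> normal_cone S p \<longrightarrow> v \<in> Ran Q \<longrightarrow>
    pt_dist p (primal_solutions Q c S) \<le> ereal r \<longrightarrow>
    norm ((v, b) - (wstar, zstar))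
      \<le> K \<kappa> * sqrt ((norm (Q *v v - Q *v p))\<^sup>2 + (norm (Q *v v + b + c))\<^sup>2)"
proof -
  obtain M where M: "0 \<le> M" "\<And>v. v \<in> Ran Q \<Longrightarrow> norm v \<le> M * norm (Q *v v)"
    using Ran_norm_bound by blast
  obtain B where B: "0 < B" "\<And>h. norm (Q *v h) \<le> norm h * B"
    using bounded_linear.pos_bounded[OF matrix_vector_mul_bounded_linear[of Q]] by blast
  have "norm ((v, b) - (wstar, zstar))
      \<le> 2 * ((M + 1) * (1 + B * \<kappa>) + 1) * sqrt ((norm (Q *v v - Q *v p))\<^sup>2 + (norm (Q *v v + b + c))\<^sup>2)"
    if \<kappa>: "0 \<le> \<kappa>" and eb: "error_bound_f Q c S r \<kappa>"
      and dual: "dual_solutions Q c S = {(wstar, zstar)}"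
      and p: "p \<in> S" "b \<in> normal_cone S p" and v: "v \<in> Ran Q"
      and near: "pt_dist p (primal_solutions Q c S) \<le> ereal r"
    for \<kappa> r wstar zstar v b p
  proof -
    define e g where "e = Q *v v - Q *v p" and "g = Q *v v + b + c"
    have "pt_dist p (primal_solutions Q c S) \<le> ereal (\<kappa> * norm (g - e))"
      by (rule error_bound_f_at[OF eb \<kappa> p(1) _ near]) (use p(2) in \<open>simp add: e_def g_def\<close>)
    moreover obtain \<pi> where \<pi>: "\<pi> \<in> primal_solutions Q c S"
      "pt_dist p (primal_solutions Q c S) = ereal (norm (p - \<pi>))"
      using pt_dist_attained[OF primal_solutions_closed primal_solutions_nonempty] by blast
    ultimately have "norm (p - \<pi>) \<le> \<kappa> * norm (g - e)" by simp
    also have "\<dots> \<le> \<kappa> * (norm e + norm g)"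
      using norm_triangle_ineq4[of g e] \<kappa> by (intro mult_left_mono) auto
    finally have dist: "norm (p - \<pi>) \<le> \<kappa> * (norm e + norm g)" .
    note star = dual_solution_form[OF dual \<pi>(1)]
    define h where "h = Q *v v - Q *v wstar"
    have "h = e + Q *v (p - \<pi>)"
      by (simp add: h_def e_def star(2) matrix_vector_mult_diff_distrib)
    then have "norm h \<le> norm e + norm (Q *v (p - \<pi>))"
      by (simp add: norm_triangle_ineq)
    also have "\<dots> \<le> norm e + (\<kappa> * (norm e + norm g)) * B"
      using B(2)[of "p - \<pi>"] mult_right_mono[OF dist, of B] B(1) by linarith
    also have "\<dots> \<le> (1 + B * \<kappa>) * (norm e + norm g)"
      by (simp add: algebra_simps)
    finally have h: "norm h \<le> (1 + B * \<kappa>) * (norm e + norm g)" .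
    have "norm (v - wstar) \<le> M * norm h"
      using M(2)[OF subspace_diff[OF subspace_Ran v star(1)]]
      by (simp add: h_def matrix_vector_mult_diff_distrib)
    moreover have "b - zstar = g - h"
      by (simp add: g_def h_def star)
    then have "norm (b - zstar) \<le> norm g + norm h"
      by (simp add: norm_triangle_ineq4)
    ultimately have "norm ((v, b) - (wstar, zstar)) \<le> (M + 1) * norm h + norm g"
      using norm_Pair_le[of "v - wstar" "b - zstar"] by (simp add: algebra_simps)
    also have "\<dots> \<le> (M + 1) * ((1 + B * \<kappa>) * (norm e + norm g)) + (norm e + norm g)"
      using M(1) h by (intro add_mono mult_left_mono) auto
    also have "\<dots> = ((M + 1) * (1 + B * \<kappa>) + 1) * (norm e + norm g)"
      by (simp add: algebra_simps)
    also have "\<dots> \<le> ((M + 1) * (1 + B * \<kappa>) + 1) * (2 * sqrt ((norm e)\<^sup>2 + (norm g)\<^sup>2))"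
    proof (rule mult_left_mono)
      have "norm e \<le> sqrt ((norm e)\<^sup>2 + (norm g)\<^sup>2)" "norm g \<le> sqrt ((norm e)\<^sup>2 + (norm g)\<^sup>2)"
        by (rule real_sqrt_sum_squares_ge1 real_sqrt_sum_squares_ge2)+
      then show "norm e + norm g \<le> 2 * sqrt ((norm e)\<^sup>2 + (norm g)\<^sup>2)" by linarith
    qed (use M(1) B(1) \<kappa> in simp)
    finally show ?thesis
      unfolding e_def g_def by (simp only: mult.assoc mult.left_commute)
  qed
  then show ?thesis
    by (intro exI[of _ "\<lambda>\<kappa>. 2 * ((M + 1) * (1 + B * \<kappa>) + 1)"]) blast
qed

end

section \<open>The inexact augmented Lagrangian method\<close>

locale inexact_alm = constrained_qp Q c S
  for Q :: "real^'n^'n" and c :: "real^'n" and S :: "(real^'n) set" +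
  fixes \<sigma> \<epsilon> \<delta> :: "nat \<Rightarrow> real" and w z x :: "nat \<Rightarrow> real^'n"
  assumes iterates: "alm_iterates Q c S \<sigma> w z x"
    and stop_A: "stopping_A Q c S \<epsilon> \<sigma> w x"
    and stop_B: "stopping_B Q c S \<delta> \<sigma> w x"
begin

abbreviation "\<Omega> \<equiv> primal_solutions Q c S"

definition residual :: "nat \<Rightarrow> real^'n" where
  "residual k = Q *v w (Suc k) - Q *v x (Suc k)"

lemma sigma_pos: "0 < \<sigma> k"
  and w_Ran: "w (Suc k) \<in> Ran Q"
  using iterates by (auto simp: alm_iterates_def)

lemma eps_nonneg: "0 \<le> \<epsilon> k" and eps_summable: "summable \<epsilon>"
  using stop_A by (auto simp: stopping_A_def)

lemma delta_nonneg: "0 \<le> \<delta> k" and delta_summable: "summable \<delta>"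
  using stop_B by (auto simp: stopping_B_def)

lemma x_Suc: "x (Suc k) = closest_point S (alm_u Q c (\<sigma> k) (x k) (w (Suc k)))"
proof -
  let ?u = "alm_u Q c (\<sigma> k) (x k) (w (Suc k))"
  have z: "z (Suc k) = (1 / \<sigma> k) *\<^sub>R (?u - closest_point S ?u)"
    and x: "x (Suc k) = x k - \<sigma> k *\<^sub>R (Q *v w (Suc k) + z (Suc k) + c)"
    using iterates by (auto simp: alm_iterates_def)
  have "x (Suc k) = ?u - \<sigma> k *\<^sub>R z (Suc k)"
    unfolding x alm_u_def by (simp add: algebra_simps)
  then show ?thesis
    using sigma_pos[of k] by (simp add: z)
qed

lemma x_Suc_in: "x (Suc k) \<in> S"
  unfolding x_Suc using closed_S S_ne by (rule closest_point_in_set)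

lemma dual_infeasibility: "Q *v w (Suc k) + z (Suc k) + c = (1 / \<sigma> k) *\<^sub>R (x k - x (Suc k))"
proof -
  have "x (Suc k) = x k - \<sigma> k *\<^sub>R (Q *v w (Suc k) + z (Suc k) + c)"
    using iterates by (simp add: alm_iterates_def)
  then have "x k - x (Suc k) = \<sigma> k *\<^sub>R (Q *v w (Suc k) + z (Suc k) + c)"
    by simp
  then show ?thesis
    using sigma_pos[of k] by simp
qed

lemma z_Suc: "z (Suc k) = (1 / \<sigma> k) *\<^sub>R (x k - x (Suc k)) - (Q *v w (Suc k) + c)"
  using dual_infeasibility[of k] by (simp add: algebra_simps)

lemma z_Suc_residual:
  "z (Suc k) = (1 / \<sigma> k) *\<^sub>R (x k - x (Suc k)) - residual k - (Q *v x (Suc k) + c)"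
  by (simp add: z_Suc residual_def)

lemma z_Suc_normal: "z (Suc k) \<in> normal_cone S (x (Suc k))"
proof -
  let ?u = "alm_u Q c (\<sigma> k) (x k) (w (Suc k))"
  have z: "z (Suc k) = (1 / \<sigma> k) *\<^sub>R (?u - x (Suc k))"
    using iterates unfolding x_Suc by (simp add: alm_iterates_def)
  have "(?u - x (Suc k)) \<bullet> (y - x (Suc k)) \<le> 0" if "y \<in> S" for y
    unfolding x_Suc by (rule closest_point_dot[OF convex_S closed_S that])
  then show ?thesis
    unfolding normal_cone_def z inner_scaleR_left
    using sigma_pos[of k] by (auto intro: divide_nonpos_pos)
qed

lemma residual_Ran: "residual k \<in> Ran Q"
  unfolding residual_def by (intro subspace_diff[OF subspace_Ran]) simp_all

lemma gradient_eq_residual: "gradient (alm_psi Q c S (\<sigma> k) (x k)) (w (Suc k)) = residual k"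
  unfolding residual_def gradient_alm_psi[OF sigma_pos] x_Suc ..

lemma residual_A: "norm (residual k) \<le> sqrt (min_nonzero_eigenvalue Q) * (\<epsilon> k / sqrt (\<sigma> k))"
  using stop_A by (simp add: stopping_A_def gradient_eq_residual)

lemma residual_B:
  "norm (residual k)
    \<le> sqrt (min_nonzero_eigenvalue Q) * (\<delta> k / sqrt (\<sigma> k) * norm (x (Suc k) - x k))"
  using stop_B by (simp add: stopping_B_def gradient_eq_residual mult.assoc)

lemma x_Suc_normal:
  "(1 / \<sigma> k) *\<^sub>R (x k - x (Suc k)) - residual k - (Q *v x (Suc k) + c) \<in> normal_cone S (x (Suc k))"
  using z_Suc_normal[of k] unfolding z_Suc_residual .

lemma step_towards_solution:
  assumes "y \<in> \<Omega>"
  shows "(norm (x (Suc k) - y))\<^sup>2 \<le> (x k - y) \<bullet> (x (Suc k) - y) + (\<epsilon> k)\<^sup>2 / 4"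
proof -
  have "(norm (x (Suc k) - y))\<^sup>2
      \<le> (x k - y) \<bullet> (x (Suc k) - y) + \<sigma> k * (\<epsilon> k / sqrt (\<sigma> k))\<^sup>2 / 4"
    by (rule inexact_proximal_step[OF x_Suc_in x_Suc_normal _ _ sigma_pos residual_Ran residual_A])
      (use assms in \<open>simp_all add: primal_solution_iff\<close>)
  then show ?thesis
    using sigma_pos[of k] by (simp add: power_divide)
qed

lemma quasi_Fejer:
  assumes "y \<in> \<Omega>"
  shows "norm (x (Suc k) - y) \<le> norm (x k - y) + \<epsilon> k"
proof (rule ccontr)
  let ?a = "norm (x (Suc k) - y)" and ?b = "norm (x k - y)"
  assume "\<not> ?a \<le> ?b + \<epsilon> k"
  then have less: "\<epsilon> k < ?a - ?b" by simp
  have "?a\<^sup>2 \<le> ?b * ?a + (\<epsilon> k)\<^sup>2 / 4"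
    using step_towards_solution[OF assms, of k] norm_cauchy_schwarz[of "x k - y" "x (Suc k) - y"]
    by linarith
  moreover have "\<epsilon> k * \<epsilon> k \<le> ?a * (?a - ?b)"
    using less eps_nonneg[of k] norm_ge_zero[of "x k - y"] by (intro mult_mono) linarith+
  moreover have "0 < ?a * (?a - ?b)"
    using less eps_nonneg[of k] norm_ge_zero[of "x k - y"] by (intro mult_pos_pos) linarith+
  ultimately show False
    by (simp add: power2_eq_square right_diff_distrib mult.commute)
qed

lemma step_length_bound:
  assumes "y \<in> \<Omega>"
  shows "(norm (x (Suc k) - x k))\<^sup>2
    \<le> (norm (x k - y))\<^sup>2 - (norm (x (Suc k) - y))\<^sup>2 + (\<epsilon> k)\<^sup>2 / 2"
proof -
  have "(norm (x (Suc k) - x k))\<^sup>2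
      = (norm (x k - y))\<^sup>2 + (norm (x (Suc k) - y))\<^sup>2 - 2 * ((x k - y) \<bullet> (x (Suc k) - y))"
    by (simp add: power2_norm_eq_inner inner_diff_left inner_diff_right inner_commute)
  then show ?thesis
    using step_towards_solution[OF assms, of k] by linarith
qed

lemma dist_to_solution_convergent:
  assumes "y \<in> \<Omega>"
  shows "convergent (\<lambda>k. norm (x k - y))"
  using quasi_Fejer[OF assms] eps_summable
  by (intro quasi_decreasing_convergent[where \<epsilon> = \<epsilon>]) auto

lemma steps_tendsto_0: "(\<lambda>k. x k - x (Suc k)) \<longlonglongrightarrow> 0"
proof -
  obtain y where y: "y \<in> \<Omega>"
    using primal_solutions_nonempty by blast
  obtain L where L: "(\<lambda>k. norm (x k - y)) \<longlonglongrightarrow> L"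
    using dist_to_solution_convergent[OF y] by (auto simp: convergent_def)
  have "(\<lambda>k. (norm (x k - y))\<^sup>2 - (norm (x (Suc k) - y))\<^sup>2 + (\<epsilon> k)\<^sup>2 / 2) \<longlonglongrightarrow> L\<^sup>2 - L\<^sup>2 + 0\<^sup>2 / 2"
    using summable_LIMSEQ_zero[OF eps_summable] by (intro tendsto_intros L LIMSEQ_Suc[OF L]) auto
  then have lim: "(\<lambda>k. (norm (x k - y))\<^sup>2 - (norm (x (Suc k) - y))\<^sup>2 + (\<epsilon> k)\<^sup>2 / 2) \<longlonglongrightarrow> 0"
    by simp
  have "(\<lambda>k. (norm (x (Suc k) - x k))\<^sup>2) \<longlonglongrightarrow> 0"
    by (rule tendsto_sandwich[OF _ _ tendsto_const lim]) (auto simp: step_length_bound[OF y])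
  then have "(\<lambda>k. sqrt ((norm (x (Suc k) - x k))\<^sup>2)) \<longlonglongrightarrow> sqrt 0"
    by (rule tendsto_real_sqrt)
  then have "(\<lambda>k. norm (x k - x (Suc k))) \<longlonglongrightarrow> 0"
    by (simp add: norm_minus_commute)
  then show ?thesis
    by (rule tendsto_norm_zero_cancel)
qed

lemma multiplication_tendsto: "(f \<longlongrightarrow> l) F \<Longrightarrow> ((\<lambda>k. Q *v f k) \<longlongrightarrow> Q *v l) F"
  by (rule bounded_linear.tendsto[OF matrix_vector_mul_bounded_linear])

lemma residual_tendsto_0:
  assumes "(\<lambda>k. 1 / \<sigma> k) \<longlonglongrightarrow> i"
  shows "residual \<longlonglongrightarrow> 0"
proof (rule Lim_null_comparison)
  have "(\<lambda>k. sqrt (min_nonzero_eigenvalue Q) * (\<epsilon> k * sqrt (1 / \<sigma> k)))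
      \<longlonglongrightarrow> sqrt (min_nonzero_eigenvalue Q) * (0 * sqrt i)"
    by (intro tendsto_intros assms summable_LIMSEQ_zero[OF eps_summable])
  then show "(\<lambda>k. sqrt (min_nonzero_eigenvalue Q) * (\<epsilon> k * sqrt (1 / \<sigma> k))) \<longlonglongrightarrow> 0"
    by simp
  show "\<forall>\<^sub>F k in sequentially. norm (residual k)
      \<le> sqrt (min_nonzero_eigenvalue Q) * (\<epsilon> k * sqrt (1 / \<sigma> k))"
    using residual_A by (simp add: real_sqrt_divide)
qed

text \<open>Some subsequence converges in the compact set \<open>S\<close>. Along it both the scaled steps and the
  residuals vanish, so the limit satisfies the optimality condition; quasi-Fejer monotonicity with
  respect to this very limit extends the convergence to the whole sequence.\<close>

lemma primal_convergence:
  assumes i: "(\<lambda>k. 1 / \<sigma> k) \<longlonglongrightarrow> i"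
  obtains xstar where "xstar \<in> \<Omega>" "x \<longlonglongrightarrow> xstar"
proof -
  obtain l \<rho> where l: "l \<in> S" and \<rho>: "strict_mono \<rho>" and lim: "((\<lambda>k. x (Suc k)) \<circ> \<rho>) \<longlonglongrightarrow> l"
    using compact_S x_Suc_in unfolding compact_def by metis
  define R where "R k = (1 / \<sigma> k) *\<^sub>R (x k - x (Suc k)) - residual k" for k
  have "R \<longlonglongrightarrow> i *\<^sub>R 0 - 0"
    unfolding R_def by (intro tendsto_intros i steps_tendsto_0 residual_tendsto_0[OF i])
  then have "R \<longlonglongrightarrow> 0" by simp
  then have R: "(\<lambda>j. R (\<rho> j)) \<longlonglongrightarrow> 0"
    using LIMSEQ_subseq_LIMSEQ[OF _ \<rho>] by (auto simp: comp_def)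
  have lim': "(\<lambda>j. x (Suc (\<rho> j))) \<longlonglongrightarrow> l"
    using lim by (simp add: comp_def)
  have "- (Q *v l + c) \<bullet> (y - l) \<le> 0" if "y \<in> S" for y
  proof -
    have "(\<lambda>j. (R (\<rho> j) - (Q *v x (Suc (\<rho> j)) + c)) \<bullet> (y - x (Suc (\<rho> j))))
        \<longlonglongrightarrow> (0 - (Q *v l + c)) \<bullet> (y - l)"
      by (intro tendsto_intros R lim' multiplication_tendsto)
    moreover have "(R (\<rho> j) - (Q *v x (Suc (\<rho> j)) + c)) \<bullet> (y - x (Suc (\<rho> j))) \<le> 0" for j
      unfolding R_def by (rule normal_coneD[OF x_Suc_normal that])
    ultimately have "(0 - (Q *v l + c)) \<bullet> (y - l) \<le> 0"
      by (intro LIMSEQ_le_const2) auto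
    then show ?thesis by simp
  qed
  then have l\<Omega>: "l \<in> \<Omega>"
    unfolding primal_solution_iff normal_cone_def using l by blast
  obtain L where L: "(\<lambda>k. norm (x k - l)) \<longlonglongrightarrow> L"
    using dist_to_solution_convergent[OF l\<Omega>] by (auto simp: convergent_def)
  have "(\<lambda>j. norm (x (Suc (\<rho> j)) - l)) \<longlonglongrightarrow> L"
    using LIMSEQ_subseq_LIMSEQ[OF LIMSEQ_Suc[OF L] \<rho>] by (simp add: comp_def)
  moreover have "(\<lambda>j. norm (x (Suc (\<rho> j)) - l)) \<longlonglongrightarrow> norm (l - l)"
    by (intro tendsto_intros lim')
  ultimately have "L = norm (l - l)"
    by (rule LIMSEQ_unique)
  then have "(\<lambda>k. norm (x k - l)) \<longlonglongrightarrow> 0"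
    using L by simp
  then have "x \<longlonglongrightarrow> l"
    by (simp add: LIM_zero_iff tendsto_norm_zero_iff)
  then show ?thesis
    using that l\<Omega> by blast
qed

lemma dual_convergence:
  assumes i: "(\<lambda>k. 1 / \<sigma> k) \<longlonglongrightarrow> i" and xs: "xstar \<in> \<Omega>" "x \<longlonglongrightarrow> xstar"
    and dual: "dual_solutions Q c S = {(wstar, zstar)}"
  shows "(\<lambda>k. (w k, z k)) \<longlonglongrightarrow> (wstar, zstar)"
proof -
  note star = dual_solution_form[OF dual xs(1)]
  obtain M where M: "0 \<le> M" "\<And>v. v \<in> Ran Q \<Longrightarrow> norm v \<le> M * norm (Q *v v)"
    using Ran_norm_bound by blast
  have "(\<lambda>k. residual k + Q *v x (Suc k)) \<longlonglongrightarrow> 0 + Q *v xstar"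
    by (intro tendsto_intros residual_tendsto_0[OF i] multiplication_tendsto LIMSEQ_Suc[OF xs(2)])
  then have Qw: "(\<lambda>k. Q *v w (Suc k)) \<longlonglongrightarrow> Q *v xstar"
    by (simp add: residual_def)
  have "(\<lambda>k. w (Suc k) - wstar) \<longlonglongrightarrow> 0"
  proof (rule Lim_null_comparison)
    have "(\<lambda>k. M * norm (Q *v w (Suc k) - Q *v wstar)) \<longlonglongrightarrow> M * norm (Q *v xstar - Q *v wstar)"
      by (intro tendsto_intros Qw)
    then show "(\<lambda>k. M * norm (Q *v w (Suc k) - Q *v wstar)) \<longlonglongrightarrow> 0"
      by (simp add: star)
    show "\<forall>\<^sub>F k in sequentially. norm (w (Suc k) - wstar) \<le> M * norm (Q *v w (Suc k) - Q *v wstar)"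
      using M(2)[OF subspace_diff[OF subspace_Ran w_Ran star(1)]]
      by (simp add: matrix_vector_mult_diff_distrib)
  qed
  then have "(\<lambda>k. w (Suc k)) \<longlonglongrightarrow> wstar"
    by (simp add: LIM_zero_iff)
  moreover have "(\<lambda>k. (1 / \<sigma> k) *\<^sub>R (x k - x (Suc k)) - (Q *v w (Suc k) + c))
      \<longlonglongrightarrow> i *\<^sub>R 0 - (Q *v xstar + c)"
    by (intro tendsto_intros i steps_tendsto_0 Qw)
  then have "(\<lambda>k. z (Suc k)) \<longlonglongrightarrow> zstar"
    by (simp add: z_Suc star(3))
  ultimately have "(\<lambda>k. (w (Suc k), z (Suc k))) \<longlonglongrightarrow> (wstar, zstar)"
    by (rule tendsto_Pair)
  then show ?thesis
    by (rule LIMSEQ_imp_Suc)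
qed

lemma iterates_near_solutions:
  assumes "pt_dist (x 0) \<Omega> \<le> ereal (r - (\<Sum>k. \<epsilon> k))"
  shows "pt_dist (x k) \<Omega> \<le> ereal r"
proof -
  obtain \<pi> where \<pi>: "\<pi> \<in> \<Omega>" "pt_dist (x 0) \<Omega> = ereal (norm (x 0 - \<pi>))"
    using pt_dist_attained[OF primal_solutions_closed primal_solutions_nonempty] by blast
  have "norm (x k - \<pi>) \<le> norm (x 0 - \<pi>) + (\<Sum>j<k. \<epsilon> j)"
  proof (induction k)
    case (Suc k)
    then show ?case
      using quasi_Fejer[OF \<pi>(1), of k] by simp
  qed simp
  moreover have "(\<Sum>j<k. \<epsilon> j) \<le> (\<Sum>k. \<epsilon> k)"
    using eps_summable eps_nonneg by (intro sum_le_suminf) auto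
  ultimately have "norm (x k - \<pi>) \<le> r"
    using assms \<pi>(2) by simp
  then show ?thesis
    using pt_dist_le[OF \<pi>(1), of "x k"] by (meson ereal_less_eq(3) order_trans)
qed

text \<open>Let \<open>y\<close> be the exact proximal point of \<open>x k\<close>. In passing from \<open>x k\<close> to \<open>y\<close> the squared distance
  to any solution drops by at least the squared step length, while the error bound at \<open>y\<close> bounds
  the distance of \<open>y\<close> to the solutions by a multiple of the step length; together they give the
  contraction. The iterate \<open>x (Suc k)\<close> differs from \<open>y\<close> by at most \<open>\<delta> k / 2\<close> times its own
  step.\<close>

lemma primal_rate_step:
  assumes eb: "error_bound_f Q c S r \<kappa>" "0 < \<kappa>" and near: "pt_dist (x k) \<Omega> \<le> ereal r"
    and \<delta>: "\<delta> k < 1"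
  shows "pt_dist (x (Suc k)) \<Omega> \<le> ereal (primal_rate \<kappa> (\<sigma> k) (\<delta> k)) * pt_dist (x k) \<Omega>"
proof -
  note s = sigma_pos[of k]
  obtain y where y: "y \<in> S" "(1 / \<sigma> k) *\<^sub>R (x k - y) - (Q *v y + c) \<in> normal_cone S y"
    using proximal_point_exists[OF s] by blast
  obtain \<pi> where \<pi>: "\<pi> \<in> \<Omega>" "pt_dist (x k) \<Omega> = ereal (norm (x k - \<pi>))"
    using pt_dist_attained[OF primal_solutions_closed primal_solutions_nonempty] by blast
  obtain \<pi>' where \<pi>': "\<pi>' \<in> \<Omega>" "pt_dist y \<Omega> = ereal (norm (y - \<pi>'))"
    using pt_dist_attained[OF primal_solutions_closed primal_solutions_nonempty] by blast
  define D a f n where "D = norm (x k - \<pi>)" and "a = norm (x k - y)"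
    and "f = norm (y - \<pi>')" and "n = norm (x (Suc k) - y)"
  define \<theta> where "\<theta> = \<kappa> / sqrt (\<kappa>\<^sup>2 + (\<sigma> k)\<^sup>2)"
  have nonneg: "0 \<le> D" "0 \<le> a" "0 \<le> f" "0 \<le> n" "0 \<le> \<theta>"
    using eb(2) by (auto simp: D_def a_def f_def n_def \<theta>_def)
  \<comment> \<open>firm nonexpansiveness towards the fixed point \<open>\<pi>\<close> of the proximal map\<close>
  have "(norm (y - \<pi>))\<^sup>2 \<le> (x k - \<pi>) \<bullet> (y - \<pi>) + \<sigma> k * 0\<^sup>2 / 4"
    by (rule inexact_proximal_step[where e = 0])
      (use y s \<pi>(1) subspace_0[OF subspace_Ran] in \<open>simp_all add: primal_solution_iff\<close>)
  moreover have "(norm (x k - y))\<^sup>2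
      = (norm (x k - \<pi>))\<^sup>2 + (norm (y - \<pi>))\<^sup>2 - 2 * ((x k - \<pi>) \<bullet> (y - \<pi>))"
    by (simp add: power2_norm_eq_inner inner_diff_left inner_diff_right inner_commute)
  ultimately have pyth: "(norm (y - \<pi>))\<^sup>2 + a\<^sup>2 \<le> D\<^sup>2"
    by (simp add: D_def a_def)
  have f_le: "f \<le> norm (y - \<pi>)"
    using pt_dist_le[OF \<pi>(1), of y] \<pi>'(2) by (simp add: f_def)
  then have fa: "f\<^sup>2 + a\<^sup>2 \<le> D\<^sup>2"
    using pyth nonneg(3) power_mono[of f "norm (y - \<pi>)" 2] by linarith
  have "f\<^sup>2 \<le> D\<^sup>2" "a\<^sup>2 \<le> D\<^sup>2"
    using fa zero_le_power2[of a] zero_le_power2[of f] by linarith+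
  then have fD: "f \<le> D" and aD: "a \<le> D"
    using nonneg by (auto intro: power2_le_imp_le)
  have "pt_dist y \<Omega> \<le> ereal r"
    using fD near \<pi>(2) \<pi>'(2) by (simp add: f_def D_def)
  then have "pt_dist y \<Omega> \<le> ereal (\<kappa> * norm ((1 / \<sigma> k) *\<^sub>R (x k - y)))"
    using eb by (intro error_bound_f_at[OF _ _ y]) auto
  moreover have step: "norm ((1 / \<sigma> k) *\<^sub>R (x k - y)) = a / \<sigma> k"
    using s by (simp add: a_def)
  ultimately have "f \<le> \<kappa> * (a / \<sigma> k)"
    unfolding step \<pi>'(2) f_def[symmetric] by simp
  then have "\<sigma> k * f \<le> \<kappa> * a"
    using s by (simp add: field_simps)
  then have "(\<sigma> k * f)\<^sup>2 \<le> (\<kappa> * a)\<^sup>2"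
    using s nonneg(3) by (intro power_mono) auto
  also have "\<dots> = \<kappa>\<^sup>2 * a\<^sup>2"
    by (simp add: power_mult_distrib)
  also have "\<dots> \<le> \<kappa>\<^sup>2 * (D\<^sup>2 - f\<^sup>2)"
    using fa by (intro mult_left_mono) auto
  finally have "(f * sqrt (\<kappa>\<^sup>2 + (\<sigma> k)\<^sup>2))\<^sup>2 \<le> (\<kappa> * D)\<^sup>2"
    by (simp add: power_mult_distrib algebra_simps)
  then have "f * sqrt (\<kappa>\<^sup>2 + (\<sigma> k)\<^sup>2) \<le> \<kappa> * D"
    by (rule power2_le_imp_le) (use eb(2) nonneg(1) in simp)
  moreover have "0 < sqrt (\<kappa>\<^sup>2 + (\<sigma> k)\<^sup>2)"
    using s eb(2) by (simp add: add_pos_pos)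
  ultimately have f\<theta>: "f \<le> \<theta> * D"
    by (simp add: \<theta>_def field_simps)
  have "n\<^sup>2 \<le> (x k - x k) \<bullet> (x (Suc k) - y)
      + \<sigma> k * (\<delta> k / sqrt (\<sigma> k) * norm (x (Suc k) - x k))\<^sup>2 / 4"
    unfolding n_def
    by (rule inexact_proximal_step[OF x_Suc_in x_Suc_normal y s residual_Ran residual_B])
  also have "\<dots> = (\<delta> k / 2 * norm (x (Suc k) - x k))\<^sup>2"
    using s by (simp add: power_mult_distrib power_divide)
  finally have "n \<le> \<delta> k / 2 * norm (x (Suc k) - x k)"
    by (rule power2_le_imp_le) (use delta_nonneg[of k] in simp)
  also have "\<dots> \<le> \<delta> k / 2 * (n + D)"
    using delta_nonneg[of k] aD norm_triangle_ineq[of "x (Suc k) - y" "y - x k"]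
    by (intro mult_left_mono) (auto simp: n_def a_def norm_minus_commute)
  \<comment> \<open>this weakens \<open>n * (1 - \<delta> k / 2) \<le> \<delta> k / 2 * D\<close> to the form of the claimed rate\<close>
  finally have n: "n * (1 - \<delta> k) \<le> \<delta> k * D"
    using mult_nonneg_nonneg[OF delta_nonneg[of k] nonneg(1)]
      mult_nonneg_nonneg[OF delta_nonneg[of k] nonneg(4)] by (simp add: field_simps)
  have "f * (1 - \<delta> k) \<le> (\<theta> * D) * (1 + \<delta> k)"
    using f\<theta> delta_nonneg[of k] \<delta> nonneg by (intro mult_mono) auto
  then have "(n + f) * (1 - \<delta> k) \<le> (\<delta> k + (1 + \<delta> k) * \<theta>) * D"
    using n by (simp add: algebra_simps)
  then have "n + f \<le> (\<delta> k + (1 + \<delta> k) * \<theta>) * D / (1 - \<delta> k)"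
    using \<delta> by (simp add: pos_le_divide_eq)
  then have "n + f \<le> primal_rate \<kappa> (\<sigma> k) (\<delta> k) * D"
    by (simp add: primal_rate_def \<theta>_def)
  moreover have "pt_dist (x (Suc k)) \<Omega> \<le> ereal (n + f)"
    using pt_dist_le[OF \<pi>'(1), of "x (Suc k)"] norm_triangle_ineq[of "x (Suc k) - y" "y - \<pi>'"]
    by (auto simp: n_def f_def intro: order_trans)
  ultimately show ?thesis
    unfolding \<pi>(2) D_def[symmetric] by (auto intro: order_trans)
qed

text \<open>The left-hand side is the norm of the element of \<open>T_l\<close> that the iterate produces: its first part
  is the gradient residual, bounded by the second stopping criterion, and its last part is the
  scaled step.\<close>

lemma optimality_residual_bound:
  "sqrt ((norm (Q *v w (Suc k) - Q *v x (Suc k)))\<^sup>2 + (norm (Q *v w (Suc k) + z (Suc k) + c))\<^sup>2)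
    \<le> sqrt (1 / (\<sigma> k)\<^sup>2 + min_nonzero_eigenvalue Q * (\<delta> k)\<^sup>2 / \<sigma> k) * norm (x (Suc k) - x k)"
proof -
  let ?m = "min_nonzero_eigenvalue Q" and ?a = "norm (x (Suc k) - x k)"
  note s = sigma_pos[of k]
  have "(norm (residual k))\<^sup>2 \<le> (sqrt ?m * (\<delta> k / sqrt (\<sigma> k) * ?a))\<^sup>2"
    by (intro power_mono residual_B) simp
  also have "\<dots> = ?m * (\<delta> k)\<^sup>2 / \<sigma> k * ?a\<^sup>2"
    using s min_eigenvalue_nonneg by (simp add: power_mult_distrib power_divide)
  finally have "(norm (residual k))\<^sup>2 + (norm (Q *v w (Suc k) + z (Suc k) + c))\<^sup>2
      \<le> (1 / (\<sigma> k)\<^sup>2 + ?m * (\<delta> k)\<^sup>2 / \<sigma> k) * ?a\<^sup>2"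
    unfolding dual_infeasibility
    by (simp add: norm_minus_commute power_divide distrib_right)
  then have "sqrt ((norm (residual k))\<^sup>2 + (norm (Q *v w (Suc k) + z (Suc k) + c))\<^sup>2)
      \<le> sqrt ((1 / (\<sigma> k)\<^sup>2 + ?m * (\<delta> k)\<^sup>2 / \<sigma> k) * ?a\<^sup>2)"
    by (rule real_sqrt_le_mono)
  then show ?thesis
    by (simp add: real_sqrt_mult residual_def)
qed

lemma dual_rate_of_bound:
  assumes "norm ((w (Suc k), z (Suc k)) - (wstar, zstar))
      \<le> K * sqrt ((norm (Q *v w (Suc k) - Q *v x (Suc k)))\<^sup>2 + (norm (Q *v w (Suc k) + z (Suc k) + c))\<^sup>2)"
    and "K \<le> \<kappa>" "0 \<le> \<kappa>"
  shows "norm ((w (Suc k), z (Suc k)) - (wstar, zstar))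
    \<le> dual_rate Q \<kappa> (\<sigma> k) (\<delta> k) * norm (x (Suc k) - x k)"
proof -
  let ?s = "sqrt ((norm (Q *v w (Suc k) - Q *v x (Suc k)))\<^sup>2 + (norm (Q *v w (Suc k) + z (Suc k) + c))\<^sup>2)"
  have "K * ?s \<le> \<kappa> * ?s"
    using assms(2) by (intro mult_right_mono) auto
  also have "\<dots> \<le> \<kappa> * (sqrt (1 / (\<sigma> k)\<^sup>2 + min_nonzero_eigenvalue Q * (\<delta> k)\<^sup>2 / \<sigma> k)
      * norm (x (Suc k) - x k))"
    using assms(3) by (intro mult_left_mono optimality_residual_bound)
  finally show ?thesis
    using assms(1) by (simp add: dual_rate_def mult.assoc)
qed

end

section \<open>Limits of the rates\<close>

lemma dual_rate_tendsto:
  assumes "(\<lambda>k. 1 / \<sigma> k) \<longlonglongrightarrow> i" "0 \<le> i" "\<delta> \<longlonglongrightarrow> 0"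
  shows "(\<lambda>k. dual_rate Q \<kappa> (\<sigma> k) (\<delta> k)) \<longlonglongrightarrow> \<kappa> * i"
proof -
  have "(\<lambda>k. \<kappa> * sqrt ((1 / \<sigma> k)\<^sup>2 + min_nonzero_eigenvalue Q * (\<delta> k)\<^sup>2 * (1 / \<sigma> k)))
      \<longlonglongrightarrow> \<kappa> * sqrt (i\<^sup>2 + min_nonzero_eigenvalue Q * 0\<^sup>2 * i)"
    by (intro tendsto_intros assms)
  then show ?thesis
    using assms(2) by (simp add: dual_rate_def power_divide)
qed

lemma primal_rate_tendsto:
  assumes "\<sigma> \<longlonglongrightarrow> s" "0 < s" "\<delta> \<longlonglongrightarrow> 0"
  shows "(\<lambda>k. primal_rate \<kappa> (\<sigma> k) (\<delta> k)) \<longlonglongrightarrow> \<kappa> / sqrt (\<kappa>\<^sup>2 + s\<^sup>2)"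
proof -
  have "0 < \<kappa>\<^sup>2 + s\<^sup>2"
    using assms(2) by (simp add: add_nonneg_pos)
  then have "(\<lambda>k. primal_rate \<kappa> (\<sigma> k) (\<delta> k)) \<longlonglongrightarrow> (0 + (1 + 0) * \<kappa> / sqrt (\<kappa>\<^sup>2 + s\<^sup>2)) / (1 - 0)"
    unfolding primal_rate_def by (intro tendsto_intros assms) auto
  then show ?thesis by simp
qed

lemma primal_rate_tendsto_0:
  assumes "filterlim \<sigma> at_top sequentially" "\<delta> \<longlonglongrightarrow> 0"
  shows "(\<lambda>k. primal_rate \<kappa> (\<sigma> k) (\<delta> k)) \<longlonglongrightarrow> 0"
proof -
  have "filterlim (\<lambda>k. sqrt (\<kappa>\<^sup>2 + (\<sigma> k)\<^sup>2)) at_top sequentially"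
    by (rule filterlim_at_top_mono[OF assms(1)]) (intro always_eventually allI real_sqrt_sum_squares_ge2)
  then have "filterlim (\<lambda>k. sqrt (\<kappa>\<^sup>2 + (\<sigma> k)\<^sup>2)) at_infinity sequentially"
    by (rule filterlim_at_top_imp_at_infinity)
  moreover have "(\<lambda>k. (1 + \<delta> k) * \<kappa>) \<longlonglongrightarrow> (1 + 0) * \<kappa>"
    by (intro tendsto_intros assms)
  ultimately have "(\<lambda>k. (1 + \<delta> k) * \<kappa> / sqrt (\<kappa>\<^sup>2 + (\<sigma> k)\<^sup>2)) \<longlonglongrightarrow> 0"
    by (intro tendsto_divide_0)
  then have "(\<lambda>k. primal_rate \<kappa> (\<sigma> k) (\<delta> k)) \<longlonglongrightarrow> (0 + 0) / (1 - 0)"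
    unfolding primal_rate_def by (intro tendsto_intros assms) auto
  then show ?thesis by simp
qed

lemma penalty_inverse_tendsto:
  assumes "(\<lambda>k. ereal (\<sigma> k)) \<longlonglongrightarrow> \<sigma>inf" "0 < \<sigma>inf"
  obtains (finite) s where "\<sigma>inf = ereal s" "0 < s" "\<sigma> \<longlonglongrightarrow> s" "(\<lambda>k. 1 / \<sigma> k) \<longlonglongrightarrow> 1 / s"
    | (infinite) "\<sigma>inf = \<infinity>" "filterlim \<sigma> at_top sequentially" "(\<lambda>k. 1 / \<sigma> k) \<longlonglongrightarrow> 0"
proof (cases \<sigma>inf)
  case (real s)
  then have "0 < s" and lim: "\<sigma> \<longlonglongrightarrow> s"
    using assms by (auto simp: lim_ereal)
  moreover have "(\<lambda>k. 1 / \<sigma> k) \<longlonglongrightarrow> 1 / s"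
    using \<open>0 < s\<close> by (intro tendsto_intros lim) auto
  ultimately show ?thesis
    using finite real by blast
next
  case PInf
  then have top: "filterlim \<sigma> at_top sequentially"
    using assms(1) by (simp add: tendsto_PInfty_eq_at_top)
  then have "(\<lambda>k. inverse (\<sigma> k)) \<longlonglongrightarrow> 0"
    by (rule tendsto_inverse_0_at_top)
  then show ?thesis
    using infinite[OF PInf top] by (simp add: inverse_eq_divide)
qed (use assms in auto)

section \<open>The box-constrained problem with one linear equation\<close>

lemma feasible_set_eq: "feasible_set a d l u = cbox l u \<inter> {x. a \<bullet> x = d}"
  by (auto simp: feasible_set_def mem_box_cart)

lemma feasible_set_convex: "convex (feasible_set a d l u)"
  unfolding feasible_set_eq by (intro convex_Int convex_box convex_hyperplane)

lemma feasible_set_compact: "compact (feasible_set a d l u)"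
  unfolding feasible_set_eq by (intro compact_Int_closed compact_cbox closed_hyperplane)

theorem theorem1:
  fixes Q :: "real^'n^'n" and c a l u wstar zstar :: "real^'n" and d r :: real
    and S \<Omega>P :: "(real^'n) set"
  assumes Q_sym: "transpose Q = Q"
    and Q_psd: "\<And>v. 0 \<le> v \<bullet> (Q *v v)"
    and bounds: "\<And>i. l $ i < u $ i"
    and S_eq: "S = feasible_set a d l u"
    and S_nonempty: "S \<noteq> {}"
    and OmegaP_eq: "\<Omega>P = primal_solutions Q c S"
    and dual_unique: "dual_solutions Q c S = {(wstar, zstar)}"
    and r_pos: "0 < r"
  shows "\<exists>K :: real \<Rightarrow> real.
    \<forall>(\<sigma> :: nat \<Rightarrow> real) (\<sigma>inf :: ereal) (\<epsilon> :: nat \<Rightarrow> real) (\<delta> :: nat \<Rightarrow> real)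
     (w :: nat \<Rightarrow> real^'n) (z :: nat \<Rightarrow> real^'n) (x :: nat \<Rightarrow> real^'n).
      alm_iterates Q c S \<sigma> w z x \<and>
      stopping_A Q c S \<epsilon> \<sigma> w x \<and> stopping_B Q c S \<delta> \<sigma> w x \<and>
      (\<lambda>k. ereal (\<sigma> k)) \<longlonglongrightarrow> \<sigma>inf \<and> 0 < \<sigma>inf \<and>
      (\<Sum>k. \<epsilon> k) < r
      \<longrightarrow>
      (\<exists>xstar\<in>\<Omega>P.
        x \<longlonglongrightarrow> xstar \<and>
        (\<lambda>k. (w k, z k)) \<longlonglongrightarrow> (wstar, zstar) \<and>
        (\<forall>\<kappa>f \<kappa>l. 0 < \<kappa>f \<and> 0 < \<kappa>l \<and>
            error_bound_f Q c S r \<kappa>f \<and>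
            error_bound_l Q c S r (wstar, zstar, xstar) \<kappa>l
          \<longrightarrow>
            (pt_dist (x 0) \<Omega>P \<le> ereal (r - (\<Sum>k. \<epsilon> k)) \<longrightarrow>
              (\<forall>k>0.
                (\<delta> k < 1 \<longrightarrow>
                  pt_dist (x (Suc k)) \<Omega>P
                    \<le> ereal (primal_rate \<kappa>f (\<sigma> k) (\<delta> k)) * pt_dist (x k) \<Omega>P) \<and>
                (K \<kappa>f \<le> \<kappa>l \<or>
                 norm ((w (Suc k), z (Suc k), x (Suc k)) - (wstar, zstar, xstar)) \<le> r \<longrightarrow>
                  norm ((w (Suc k), z (Suc k)) - (wstar, zstar))
                    \<le> dual_rate Q \<kappa>l (\<sigma> k) (\<delta> k) * norm (x (Suc k) - x k)))) \<and>
            (\<forall>s. \<sigma>inf = ereal s \<longrightarrow>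
              (\<lambda>k. primal_rate \<kappa>f (\<sigma> k) (\<delta> k)) \<longlonglongrightarrow> \<kappa>f / sqrt (\<kappa>f\<^sup>2 + s\<^sup>2) \<and>
              (\<lambda>k. dual_rate Q \<kappa>l (\<sigma> k) (\<delta> k)) \<longlonglongrightarrow> \<kappa>l / s) \<and>
            (\<sigma>inf = \<infinity> \<longrightarrow>
              (\<lambda>k. primal_rate \<kappa>f (\<sigma> k) (\<delta> k)) \<longlonglongrightarrow> 0 \<and>
              (\<lambda>k. dual_rate Q \<kappa>l (\<sigma> k) (\<delta> k)) \<longlonglongrightarrow> 0)))"
proof -
  interpret constrained_qp Q c S
    using Q_sym Q_psd feasible_set_convex[of a d l u] feasible_set_compact[of a d l u] S_nonempty
    unfolding S_eq by unfold_locales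
  obtain K :: "real \<Rightarrow> real" where K: "\<And>\<kappa> v b p.
      0 \<le> \<kappa> \<Longrightarrow> error_bound_f Q c S r \<kappa> \<Longrightarrow> p \<in> S \<Longrightarrow> b \<in> normal_cone S p \<Longrightarrow> v \<in> Ran Q \<Longrightarrow>
      pt_dist p (primal_solutions Q c S) \<le> ereal r \<Longrightarrow>
      norm ((v, b) - (wstar, zstar))
        \<le> K \<kappa> * sqrt ((norm (Q *v v - Q *v p))\<^sup>2 + (norm (Q *v v + b + c))\<^sup>2)"
    using dual_distance_far dual_unique by blast
  show ?thesis
  proof (rule exI[of _ K], intro allI impI)
    fix \<sigma> \<sigma>inf \<epsilon> \<delta> w z x
    assume run: "alm_iterates Q c S \<sigma> w z x \<and>
      stopping_A Q c S \<epsilon> \<sigma> w x \<and> stopping_B Q c S \<delta> \<sigma> w x \<and>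
      (\<lambda>k. ereal (\<sigma> k)) \<longlonglongrightarrow> \<sigma>inf \<and> 0 < \<sigma>inf \<and> (\<Sum>k. \<epsilon> k) < r"
    interpret inexact_alm Q c S \<sigma> \<epsilon> \<delta> w z x
      using run by unfold_locales auto
    have pen: "(\<lambda>k. ereal (\<sigma> k)) \<longlonglongrightarrow> \<sigma>inf" "0 < \<sigma>inf"
      using run by auto
    obtain i where i: "(\<lambda>k. 1 / \<sigma> k) \<longlonglongrightarrow> i"
      using penalty_inverse_tendsto[OF pen] by metis
    obtain xstar where xs: "xstar \<in> \<Omega>P" "x \<longlonglongrightarrow> xstar"
      using primal_convergence[OF i] OmegaP_eq by blast
    note \<delta>0 = summable_LIMSEQ_zero[OF delta_summable]
    have primal: "pt_dist (x (Suc k)) \<Omega>P \<le> ereal (primal_rate \<kappa>f (\<sigma> k) (\<delta> k)) * pt_dist (x k) \<Omega>P"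
      if "0 < \<kappa>f" "error_bound_f Q c S r \<kappa>f" "\<delta> k < 1"
        and "pt_dist (x 0) \<Omega>P \<le> ereal (r - (\<Sum>k. \<epsilon> k))" for \<kappa>f k
      using primal_rate_step[OF that(2,1) _ that(3)] iterates_near_solutions that(4)
      unfolding OmegaP_eq by blast
    have dual: "norm ((w (Suc k), z (Suc k)) - (wstar, zstar))
        \<le> dual_rate Q \<kappa>l (\<sigma> k) (\<delta> k) * norm (x (Suc k) - x k)"
      if \<kappa>: "0 < \<kappa>f" "0 < \<kappa>l" and eb: "error_bound_f Q c S r \<kappa>f"
          "error_bound_l Q c S r (wstar, zstar, xstar) \<kappa>l"
        and near: "pt_dist (x 0) \<Omega>P \<le> ereal (r - (\<Sum>k. \<epsilon> k))"
        and alt: "K \<kappa>f \<le> \<kappa>l \<or> norm ((w (Suc k), z (Suc k), x (Suc k)) - (wstar, zstar, xstar)) \<le> r"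
      for \<kappa>f \<kappa>l k
      using alt
    proof
      assume le: "K \<kappa>f \<le> \<kappa>l"
      have "pt_dist (x (Suc k)) (primal_solutions Q c S) \<le> ereal r"
        using iterates_near_solutions near unfolding OmegaP_eq by blast
      then show ?thesis
        using \<kappa> by (intro dual_rate_of_bound[OF K[OF _ eb(1) x_Suc_in z_Suc_normal w_Ran] le]) simp_all
    next
      assume le: "norm ((w (Suc k), z (Suc k), x (Suc k)) - (wstar, zstar, xstar)) \<le> r"
      show ?thesis
        using \<kappa>(2)
        by (intro dual_rate_of_bound[OF dual_distance_near[OF dual_unique eb(2) _ x_Suc_in
              z_Suc_normal w_Ran le]]) simp_all
    qed
    have limits: "(\<forall>s. \<sigma>inf = ereal s \<longrightarrow>
          (\<lambda>k. primal_rate \<kappa>f (\<sigma> k) (\<delta> k)) \<longlonglongrightarrow> \<kappa>f / sqrt (\<kappa>f\<^sup>2 + s\<^sup>2) \<and>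
          (\<lambda>k. dual_rate Q \<kappa>l (\<sigma> k) (\<delta> k)) \<longlonglongrightarrow> \<kappa>l / s) \<and>
        (\<sigma>inf = \<infinity> \<longrightarrow>
          (\<lambda>k. primal_rate \<kappa>f (\<sigma> k) (\<delta> k)) \<longlonglongrightarrow> 0 \<and>
          (\<lambda>k. dual_rate Q \<kappa>l (\<sigma> k) (\<delta> k)) \<longlonglongrightarrow> 0)" for \<kappa>f \<kappa>l
      using pen
    proof (cases rule: penalty_inverse_tendsto)
      case (finite s)
      then show ?thesis
        using primal_rate_tendsto[OF finite(3,2) \<delta>0, of \<kappa>f]
          dual_rate_tendsto[OF finite(4) _ \<delta>0, of Q \<kappa>l] by simp
    next
      case infinite
      then show ?thesis
        using primal_rate_tendsto_0[OF infinite(2) \<delta>0, of \<kappa>f]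
          dual_rate_tendsto[OF infinite(3) _ \<delta>0, of Q \<kappa>l] by simp
    qed
    show "\<exists>xstar\<in>\<Omega>P.
        x \<longlonglongrightarrow> xstar \<and>
        (\<lambda>k. (w k, z k)) \<longlonglongrightarrow> (wstar, zstar) \<and>
        (\<forall>\<kappa>f \<kappa>l. 0 < \<kappa>f \<and> 0 < \<kappa>l \<and>
            error_bound_f Q c S r \<kappa>f \<and>
            error_bound_l Q c S r (wstar, zstar, xstar) \<kappa>l
          \<longrightarrow>
            (pt_dist (x 0) \<Omega>P \<le> ereal (r - (\<Sum>k. \<epsilon> k)) \<longrightarrow>
              (\<forall>k>0.
                (\<delta> k < 1 \<longrightarrow>
                  pt_dist (x (Suc k)) \<Omega>P
                    \<le> ereal (primal_rate \<kappa>f (\<sigma> k) (\<delta> k)) * pt_dist (x k) \<Omega>P) \<and>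
                (K \<kappa>f \<le> \<kappa>l \<or>
                 norm ((w (Suc k), z (Suc k), x (Suc k)) - (wstar, zstar, xstar)) \<le> r \<longrightarrow>
                  norm ((w (Suc k), z (Suc k)) - (wstar, zstar))
                    \<le> dual_rate Q \<kappa>l (\<sigma> k) (\<delta> k) * norm (x (Suc k) - x k)))) \<and>
            (\<forall>s. \<sigma>inf = ereal s \<longrightarrow>
              (\<lambda>k. primal_rate \<kappa>f (\<sigma> k) (\<delta> k)) \<longlonglongrightarrow> \<kappa>f / sqrt (\<kappa>f\<^sup>2 + s\<^sup>2) \<and>
              (\<lambda>k. dual_rate Q \<kappa>l (\<sigma> k) (\<delta> k)) \<longlonglongrightarrow> \<kappa>l / s) \<and>
            (\<sigma>inf = \<infinity> \<longrightarrow>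
              (\<lambda>k. primal_rate \<kappa>f (\<sigma> k) (\<delta> k)) \<longlonglongrightarrow> 0 \<and>
              (\<lambda>k. dual_rate Q \<kappa>l (\<sigma> k) (\<delta> k)) \<longlonglongrightarrow> 0))"
    proof (intro bexI[OF _ xs(1)] conjI)
      show "(\<lambda>k. (w k, z k)) \<longlonglongrightarrow> (wstar, zstar)"
        using dual_convergence[OF i _ xs(2) dual_unique] xs(1) OmegaP_eq by blast
    qed (use xs(2) primal dual limits in blast)+
  qed
qed

end
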